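(* (i) There exists $n_0\in \mathbb{N}$ such that for all $n\ge n_0$ and any compact sets $K,T\subseteq \mathbb{R}^n$ of positive volume, each with connected boundary, satisfying $$\frac{1}{\sqrt{n}}\le \left(\frac{\mathrm{vol}(K)}{\mathrm{vol}(T)}\right)^{\frac 1n} \le \sqrt{n},$$ it holds that $$\mathrm{vol}(\partial K+\partial T)^{2/n}\ge \mathrm{vol}(K)^{2/n}+\mathrm{vol}(T)^{2/n}.$$ (ii) There exists a universal constant $C>0$ such that for all $n\ge 2$ and any compact sets $K,T\subseteq\mathbb{R}^n$ of positive volume, each with connected boundary, satisfying $$\frac{C}{\sqrt{n}}\le \left(\frac{\mathrm{vol}(K)}{\mathrm{vol}(T)}\right)^{\frac 1n} \le \frac{\sqrt{n}}{C},$$ the same inequality $\mathrm{vol}(\partial K+\partial T)^{2/n}\ge \mathrm{vol}(K)^{2/n}+\mathrm{vol}(T)^{2/n}$ holds.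
   Context: $\mathrm{vol}$ denotes Lebesgue measure on $\mathbb{R}^n$; $\partial A$ is the topological boundary of $A$; $A+B=\{a+b: a\in A, b\in B\}$ is the Minkowski sum. The constants $n_0$ and $C$ do not depend on $K$ and $T$, and $C$ does not depend on $n$. *)

theory Defs
  imports "HOL-Analysis.Analysis"
begin

text \<open>
  The dimension is quantified inside the statement, so it cannot be a type.
  A point of n-dimensional real space is a function in
  \<open>{..<n} \<rightarrow>\<^sub>E UNIV\<close>, i.e. a function with value \<open>undefined\<close> outside \<open>{..<n}\<close>.
  This set is the carrier of both the product topology and the product measure below.
\<close>

definition Rn_topology :: "nat \<Rightarrow> (nat \<Rightarrow> real) topology" where
  "Rn_topology n = product_topology (\<lambda>_. euclideanreal) {..<n}"

text \<open>
  As in the library, where \<open>lebesgue\<close> is the completion of \<open>lborel\<close>,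
  and \<open>lborel\<close> on a Euclidean space is the image of the product of the measures
  \<open>lborel\<close> on the real line.
\<close>

definition vol :: "nat \<Rightarrow> (nat \<Rightarrow> real) set \<Rightarrow> real" where
  "vol n A = measure (completion (\<Pi>\<^sub>M i\<in>{..<n}. lborel)) A"

definition minkowski_sum :: "nat \<Rightarrow> (nat \<Rightarrow> real) set \<Rightarrow> (nat \<Rightarrow> real) set \<Rightarrow> (nat \<Rightarrow> real) set" where
  "minkowski_sum n A B = {(\<lambda>i\<in>{..<n}. a i + b i) | a b. a \<in> A \<and> b \<in> B}"

end

theory Submission
  imports Defs
begin

text \<open>
  Let \<open>a\<close> and \<open>b\<close> be the \<open>n\<close>-th roots of the volumes of \<open>K\<close> and \<open>T\<close>, with \<open>b \<le> a\<close>.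
  A point \<open>x\<close> of \<open>K + T\<close> lies outside \<open>\<partial>K + \<partial>T\<close> only if \<open>K\<close> and \<open>x - T\<close>
  have disjoint boundaries; as these are connected and the two sets meet, one set contains the other.
  The set \<open>E\<close> of all \<open>x\<close> with \<open>x - T \<subseteq> K\<close> satisfies \<open>E + (- T) \<subseteq> K\<close>, so by the
  Brunn--Minkowski inequality its volume is at most \<open>(a - b) ^ n\<close>; likewise the set of all \<open>x\<close>
  with \<open>K \<subseteq> x - T\<close> is null. Since \<open>K + T\<close> has volume at least \<open>(a + b) ^ n\<close>, the sum of the
  boundaries has volume at least \<open>(a + b) ^ n - (a - b) ^ n\<close>, and this is at least
  \<open>(a\<^sup>2 + b\<^sup>2) powr (n / 2)\<close> as soon as \<open>n \<ge> 2\<close> and \<open>a \<le> sqrt n * b\<close>. Hence \<open>2\<close> and \<open>1\<close> serve as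
  \<open>n\<^sub>0\<close> and \<open>C\<close>.

  The Brunn--Minkowski inequality is proved by the method of Hadwiger and Ohmann: first for finite
  unions of boxes, cutting by a hyperplane parallel to a coordinate hyperplane, and then for compact
  sets, which are intersections of decreasing sequences of unions of dyadic cubes.
\<close>

section \<open>Boxes\<close>

abbreviation lborel_Rn :: "nat \<Rightarrow> (nat \<Rightarrow> real) measure" where
  "lborel_Rn n \<equiv> \<Pi>\<^sub>M i\<in>{..<n}. lborel"

text \<open>Half-open sides make cuts exact: a hyperplane splits such a box into two disjoint boxes
  of the same kind, one of which may be empty, and no null boundary has to be discarded.\<close>

definition half_open_box :: "nat \<Rightarrow> (nat \<Rightarrow> real) \<Rightarrow> (nat \<Rightarrow> real) \<Rightarrow> (nat \<Rightarrow> real) set" where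
  "half_open_box n l u = (\<Pi>\<^sub>E i\<in>{..<n}. {l i..<u i})"

definition half_open_boxes :: "nat \<Rightarrow> (nat \<Rightarrow> real) set set" where
  "half_open_boxes n = {half_open_box n l u | l u. \<forall>i<n. l i < u i}"

lemma mem_half_open_box:
  "x \<in> half_open_box n l u \<longleftrightarrow> x \<in> extensional {..<n} \<and> (\<forall>i<n. l i \<le> x i \<and> x i < u i)"
  by (auto simp: half_open_box_def PiE_iff)

lemma half_open_box_sets [measurable]: "half_open_box n l u \<in> sets (lborel_Rn n)"
  unfolding half_open_box_def by (intro sets_PiM_I_finite) auto

lemma emeasure_half_open_box:
  "emeasure (lborel_Rn n) (half_open_box n l u) = ennreal (\<Prod>i<n. max 0 (u i - l i))"
proof -
  interpret product_sigma_finite "\<lambda>_::nat. lborel :: real measure"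
    by (simp add: product_sigma_finite_def sigma_finite_lborel)
  have "emeasure lborel {l i..<u i} = ennreal (max 0 (u i - l i))" for i
    by (cases "l i \<le> u i") (auto simp: max_def)
  then show ?thesis
    by (simp add: half_open_box_def emeasure_PiM prod_ennreal)
qed

lemma half_open_box_fmeasurable: "half_open_box n l u \<in> fmeasurable (lborel_Rn n)"
  by (intro fmeasurableI) (auto simp: emeasure_half_open_box)

lemma measure_half_open_box:
  "measure (lborel_Rn n) (half_open_box n l u) = (\<Prod>i<n. max 0 (u i - l i))"
  by (simp add: measure_def emeasure_half_open_box prod_nonneg)

lemma half_open_boxes_fmeasurable: "B \<in> half_open_boxes n \<Longrightarrow> B \<in> fmeasurable (lborel_Rn n)"
  by (auto simp: half_open_boxes_def half_open_box_fmeasurable)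

lemma half_open_boxes_measure_pos: "B \<in> half_open_boxes n \<Longrightarrow> measure (lborel_Rn n) B > 0"
  by (auto simp: half_open_boxes_def measure_half_open_box intro!: prod_pos)

lemma half_open_boxes_nonempty: "B \<in> half_open_boxes n \<Longrightarrow> B \<noteq> {}"
  using half_open_boxes_measure_pos by fastforce

lemma half_open_box_in_boxes_iff:
  "half_open_box n l u \<in> half_open_boxes n \<longleftrightarrow> half_open_box n l u \<noteq> {}"
proof
  assume "half_open_box n l u \<noteq> {}"
  then have "\<forall>i<n. l i < u i"
    by (force simp: mem_half_open_box set_eq_iff)
  then show "half_open_box n l u \<in> half_open_boxes n"
    by (auto simp: half_open_boxes_def)
qed (rule half_open_boxes_nonempty)

lemma half_open_box_cut:
  assumes "i < n"
  shows "half_open_box n l u \<inter> {x. x i < c} = half_open_box n l (u(i := min (u i) c))"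
    and "half_open_box n l u \<inter> {x. c \<le> x i} = half_open_box n (l(i := max (l i) c)) u"
  using assms by (auto simp: mem_half_open_box fun_upd_def) (smt (verit, best))+

lemma half_open_boxes_cut:
  assumes "B \<in> half_open_boxes n" "i < n"
  shows "B \<inter> {x. x i < c} \<noteq> {} \<Longrightarrow> B \<inter> {x. x i < c} \<in> half_open_boxes n"
    and "B \<inter> {x. c \<le> x i} \<noteq> {} \<Longrightarrow> B \<inter> {x. c \<le> x i} \<in> half_open_boxes n"
proof -
  obtain l u where "B = half_open_box n l u"
    using assms(1) by (auto simp: half_open_boxes_def)
  then show "B \<inter> {x. x i < c} \<noteq> {} \<Longrightarrow> B \<inter> {x. x i < c} \<in> half_open_boxes n"
    and "B \<inter> {x. c \<le> x i} \<noteq> {} \<Longrightarrow> B \<inter> {x. c \<le> x i} \<in> half_open_boxes n"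
    using assms(2) by (simp_all add: half_open_box_cut half_open_box_in_boxes_iff)
qed

section \<open>Minkowski sums of boxes\<close>

lemma minkowski_sum_half_open_box:
  assumes "\<forall>i<n. l i < u i" "\<forall>i<n. l' i < u' i"
  shows "minkowski_sum n (half_open_box n l u) (half_open_box n l' u') =
    half_open_box n (\<lambda>i. l i + l' i) (\<lambda>i. u i + u' i)"
proof (intro equalityI subsetI)
  fix z assume z: "z \<in> half_open_box n (\<lambda>i. l i + l' i) (\<lambda>i. u i + u' i)"
  \<comment> \<open>The offset of \<open>z\<close> from the lower corner is shared between the two
    summands in proportion to the side lengths, so each share stays strictly below its own
    side.\<close>
  define x where "x = (\<lambda>i\<in>{..<n}. l i + (u i - l i) / (u i - l i + u' i - l' i) * (z i - (l i + l' i)))"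
  define y where "y = (\<lambda>i\<in>{..<n}. l' i + (u' i - l' i) / (u i - l i + u' i - l' i) * (z i - (l i + l' i)))"
  have scale: "0 \<le> a / (a + b) * w \<and> a / (a + b) * w < a" if "a > 0" "b > 0" "0 \<le> w" "w < a + b"
    for a b w :: real
    using that mult_strict_left_mono[OF \<open>w < a + b\<close> \<open>a > 0\<close>] by (simp add: field_simps)
  have x: "x \<in> half_open_box n l u"
    using z assms scale[of "u i - l i" "u' i - l' i" "z i - (l i + l' i)" for i]
    by (simp add: mem_half_open_box x_def algebra_simps)
  have y: "y \<in> half_open_box n l' u'"
    using z assms scale[of "u' i - l' i" "u i - l i" "z i - (l i + l' i)" for i]
    by (simp add: mem_half_open_box y_def algebra_simps)
  have "x i + y i = z i" if "i < n" for i
  proof -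
    have "(u i - l i) / (u i - l i + u' i - l' i) + (u' i - l' i) / (u i - l i + u' i - l' i) = 1"
      using assms that by (simp add: add_divide_distrib[symmetric]) (smt (verit))
    then have "(u i - l i) / (u i - l i + u' i - l' i) * w + (u' i - l' i) / (u i - l i + u' i - l' i) * w = w" for w
      by (metis distrib_right mult_1)
    from this[of "z i - (l i + l' i)"] that show ?thesis
      by (simp add: x_def y_def)
  qed
  then have "z = (\<lambda>i\<in>{..<n}. x i + y i)"
    using z by (auto simp: mem_half_open_box extensional_def)
  with x y show "z \<in> minkowski_sum n (half_open_box n l u) (half_open_box n l' u')"
    by (auto simp: minkowski_sum_def)
qed (auto simp: minkowski_sum_def mem_half_open_box add_mono add_strict_mono)

lemma minkowski_sum_commute: "minkowski_sum n A B = minkowski_sum n B A"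
  by (force simp: minkowski_sum_def add.commute)

lemma minkowski_sum_mono:
  "A \<subseteq> A' \<Longrightarrow> B \<subseteq> B' \<Longrightarrow> minkowski_sum n A B \<subseteq> minkowski_sum n A' B'"
  by (auto simp: minkowski_sum_def)

lemma minkowski_sum_Union:
  "minkowski_sum n (\<Union>P) (\<Union>Q) = (\<Union>B\<in>P. \<Union>C\<in>Q. minkowski_sum n B C)"
  by (auto simp: minkowski_sum_def)

lemma minkowski_sum_boxes:
  "B \<in> half_open_boxes n \<Longrightarrow> C \<in> half_open_boxes n \<Longrightarrow> minkowski_sum n B C \<in> half_open_boxes n"
  unfolding half_open_boxes_def mem_Collect_eq
  by (elim exE conjE) (metis (no_types, lifting) add_strict_mono minkowski_sum_half_open_box)

text \<open>This is the case of two single boxes with side lengths \<open>a i\<close> and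
  \<open>b i\<close>. The inequality of arithmetic and geometric means is applied to the ratios
  \<open>a i / (a i + b i)\<close> and to the ratios \<open>b i / (a i + b i)\<close>; the two
  arithmetic means add up to 1.\<close>

lemma root_prod_add:
  fixes a b :: "nat \<Rightarrow> real"
  assumes "n > 0" "\<And>i. i < n \<Longrightarrow> a i > 0" "\<And>i. i < n \<Longrightarrow> b i > 0"
  shows "root n (\<Prod>i<n. a i) + root n (\<Prod>i<n. b i) \<le> root n (\<Prod>i<n. a i + b i)"
proof -
  have gm: "root n (\<Prod>i<n. f i / (a i + b i)) \<le> (\<Sum>i<n. f i / (a i + b i)) / n"
    if "\<And>i. i < n \<Longrightarrow> f i > 0" for f
  proof -
    have nonneg: "0 \<le> f i / (a i + b i)" if "i < n" for i
      using assms \<open>\<And>i. i < n \<Longrightarrow> f i > 0\<close> that by (simp add: add_nonneg_nonneg less_imp_le)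
    have "(\<Prod>i<n. f i / (a i + b i)) powr (1 / n) \<le> (\<Sum>i<n. f i / (a i + b i) / n)"
      using arith_geom_mean[of "{..<n}" "\<lambda>i. f i / (a i + b i)"] assms(1) nonneg by (simp add: lessThan_empty_iff)
    moreover have "root n (\<Prod>i<n. f i / (a i + b i)) = (\<Prod>i<n. f i / (a i + b i)) powr (1 / n)"
      using assms(1) nonneg by (intro root_powr_inverse prod_nonneg) auto
    ultimately show ?thesis
      by (simp only: sum_divide_distrib)
  qed
  have "a i / (a i + b i) + b i / (a i + b i) = 1" if "i < n" for i
    using assms(2,3)[OF that] by (simp add: add_divide_distrib[symmetric])
  then have "(\<Sum>i<n. a i / (a i + b i)) + (\<Sum>i<n. b i / (a i + b i)) = n"
    by (simp add: sum.distrib[symmetric])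
  then have "root n (\<Prod>i<n. a i / (a i + b i)) + root n (\<Prod>i<n. b i / (a i + b i)) \<le> 1"
    using gm[of a] gm[of b] assms by (smt (verit) add_divide_distrib divide_self_if of_nat_0_less_iff)
  then have "(root n (\<Prod>i<n. a i) + root n (\<Prod>i<n. b i)) / root n (\<Prod>i<n. a i + b i) \<le> 1"
    using assms(1) by (simp add: prod_dividef real_root_divide add_divide_distrib)
  moreover have "root n (\<Prod>i<n. a i + b i) > 0"
    using assms by (intro real_root_gt_zero prod_pos) (auto intro: add_pos_pos)
  ultimately show ?thesis
    by (simp only: divide_le_eq_1_pos)
qed

section \<open>The Brunn--Minkowski inequality for unions of boxes\<close>

definition box_family :: "nat \<Rightarrow> (nat \<Rightarrow> real) set set \<Rightarrow> bool" where
  "box_family n P \<longleftrightarrow> finite P \<and> P \<subseteq> half_open_boxes n \<and> disjoint P"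

lemma box_family_fmeasurable: "box_family n P \<Longrightarrow> \<Union>P \<in> fmeasurable (lborel_Rn n)"
  unfolding box_family_def
  by (metis half_open_boxes_fmeasurable fmeasurable.finite_Union subset_iff)

lemma box_family_measure_pos:
  assumes "box_family n P" "P \<noteq> {}"
  shows "measure (lborel_Rn n) (\<Union>P) > 0"
proof -
  obtain B where "B \<in> P" using assms(2) by blast
  then have "0 < measure (lborel_Rn n) B" "B \<in> sets (lborel_Rn n)"
    using assms(1) half_open_boxes_measure_pos half_open_boxes_fmeasurable
    by (auto simp: box_family_def subset_iff)
  moreover have "measure (lborel_Rn n) B \<le> measure (lborel_Rn n) (\<Union>P)"
    using \<open>B \<in> P\<close> calculation box_family_fmeasurable[OF assms(1)]
    by (intro measure_mono_fmeasurable) auto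
  ultimately show ?thesis by linarith
qed

text \<open>The bounds on the cardinality drive the Hadwiger--Ohmann induction: cutting never
  increases the number of boxes, and it loses one as soon as some box misses
  \<open>G\<close>.\<close>

lemma box_family_Int:
  assumes P: "box_family n P" and G: "\<And>B. B \<in> P \<Longrightarrow> B \<inter> G \<noteq> {} \<Longrightarrow> B \<inter> G \<in> half_open_boxes n"
  obtains Q where "box_family n Q" "\<Union>Q = \<Union>P \<inter> G" "card Q \<le> card P"
    "(\<exists>B\<in>P. B \<inter> G = {}) \<Longrightarrow> card Q < card P"
proof
  let ?P = "{B\<in>P. B \<inter> G \<noteq> {}}" let ?Q = "(\<lambda>B. B \<inter> G) ` ?P"
  have fin: "finite P" and dis: "disjoint P"
    using P by (auto simp: box_family_def)
  have "disjoint ?Q"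
    using dis by (auto simp: disjoint_def)
  then show "box_family n ?Q"
    using fin G by (auto simp: box_family_def)
  show "\<Union>?Q = \<Union>P \<inter> G" by auto
  have card: "card ?Q \<le> card ?P"
    using fin by (intro card_image_le) auto
  also have "card ?P \<le> card P"
    using fin by (intro card_mono) auto
  finally show "card ?Q \<le> card P" .
  show "card ?Q < card P" if "\<exists>B\<in>P. B \<inter> G = {}"
  proof -
    have "?P \<subset> P" using that by blast
    then have "card ?P < card P" using fin by (rule psubset_card_mono[rotated])
    with card show ?thesis by linarith
  qed
qed

lemma box_family_cut:
  assumes P: "box_family n P" and "i < n"
  obtains Q R where "box_family n Q" "\<Union>Q = \<Union>P \<inter> {x. x i < c}" "card Q \<le> card P"
    "(\<exists>B\<in>P. B \<inter> {x. x i < c} = {}) \<Longrightarrow> card Q < card P"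
    "box_family n R" "\<Union>R = \<Union>P \<inter> {x. c \<le> x i}" "card R \<le> card P"
    "(\<exists>B\<in>P. B \<inter> {x. c \<le> x i} = {}) \<Longrightarrow> card R < card P"
proof -
  have "B \<in> half_open_boxes n" if "B \<in> P" for B
    using P that by (auto simp: box_family_def)
  note cut = half_open_boxes_cut[OF this \<open>i < n\<close>, of _ c]
  obtain Q where "box_family n Q" "\<Union>Q = \<Union>P \<inter> {x. x i < c}" "card Q \<le> card P"
    "(\<exists>B\<in>P. B \<inter> {x. x i < c} = {}) \<Longrightarrow> card Q < card P"
    using box_family_Int[OF P cut(1)] by blast
  moreover obtain R where "box_family n R" "\<Union>R = \<Union>P \<inter> {x. c \<le> x i}" "card R \<le> card P"
    "(\<exists>B\<in>P. B \<inter> {x. c \<le> x i} = {}) \<Longrightarrow> card R < card P"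
    using box_family_Int[OF P cut(2)] by blast
  ultimately show ?thesis
    by (rule that)
qed

text \<open>If in every coordinate the larger lower end were below both upper ends, the point with
  these coordinates would lie in both boxes. So in some coordinate one interval ends no later than
  the other begins.\<close>

lemma disjoint_boxes_separated:
  assumes "B \<in> half_open_boxes n" "C \<in> half_open_boxes n" "B \<inter> C = {}"
  obtains i c where "i < n" "(B \<subseteq> {x. x i < c} \<and> C \<subseteq> {x. c \<le> x i}) \<or> (C \<subseteq> {x. x i < c} \<and> B \<subseteq> {x. c \<le> x i})"
proof -
  obtain l u l' u' where B: "B = half_open_box n l u" and C: "C = half_open_box n l' u'"
    and lt: "\<forall>i<n. l i < u i" "\<forall>i<n. l' i < u' i"
    using assms(1,2) by (auto simp: half_open_boxes_def)
  have "(\<lambda>i\<in>{..<n}. max (l i) (l' i)) \<notin> B \<inter> C"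
    using assms(3) by blast
  then obtain i where "i < n" "u i \<le> l' i \<or> u' i \<le> l i"
    using lt unfolding B C by (auto simp: mem_half_open_box not_less)
  from this(2) show thesis
  proof
    assume "u i \<le> l' i"
    then have "B \<subseteq> {x. x i < u i}" "C \<subseteq> {x. u i \<le> x i}"
      using \<open>i < n\<close> by (auto simp: B C mem_half_open_box intro: order_trans)
    with \<open>i < n\<close> show thesis using that by blast
  next
    assume "u' i \<le> l i"
    then have "C \<subseteq> {x. x i < u' i}" "B \<subseteq> {x. u' i \<le> x i}"
      using \<open>i < n\<close> by (auto simp: B C mem_half_open_box intro: order_trans)
    with \<open>i < n\<close> show thesis using that by blast
  qed
qed

text \<open>The volume below the hyperplane is a finite sum of products of side lengths truncated at
  \<open>c\<close>, hence continuous in \<open>c\<close>. It runs from 0 to the full volume, so the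
  intermediate value theorem applies.\<close>

lemma box_family_bisect:
  assumes P: "box_family n P" "P \<noteq> {}" and "i < n" and \<theta>: "0 < \<theta>" "\<theta> < 1"
  obtains c where "measure (lborel_Rn n) (\<Union>P \<inter> {x. x i < c}) = \<theta> * measure (lborel_Rn n) (\<Union>P)"
proof -
  let ?f = "\<lambda>c. measure (lborel_Rn n) (\<Union>P \<inter> {x. x i < c})"
  have box: "\<exists>l u. B = half_open_box n l u" if "B \<in> P" for B
    using P that by (auto simp: box_family_def half_open_boxes_def)
  have "finite P" using P by (simp add: box_family_def)
  have "bounded ((\<lambda>x. x i) ` B)" if "B \<in> P" for B
  proof -
    obtain l u where "B = half_open_box n l u" using box \<open>B \<in> P\<close> by blast
    then have "(\<lambda>x. x i) ` B \<subseteq> {l i..u i}"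
      using \<open>i < n\<close> by (auto simp: mem_half_open_box less_imp_le)
    then show ?thesis
      using bounded_closed_interval bounded_subset by blast
  qed
  then have "bounded (\<Union>B\<in>P. (\<lambda>x. x i) ` B)"
    using \<open>finite P\<close> by (intro bounded_UN) auto
  then obtain m where m: "m > 0" "\<And>x B. B \<in> P \<Longrightarrow> x \<in> B \<Longrightarrow> \<bar>x i\<bar> \<le> m"
    by (auto simp: bounded_pos)
  have cont: "continuous_on {- m..m + 1} ?f"
  proof -
    have "?f c = (\<Sum>B\<in>P. measure (lborel_Rn n) (B \<inter> {x. x i < c}))" for c
    proof -
      have fm: "B \<inter> {x. x i < c} \<in> fmeasurable (lborel_Rn n)" if "B \<in> P" for B
        using box[OF that] \<open>i < n\<close> by (auto simp: half_open_box_cut half_open_box_fmeasurable)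
      have "measure (lborel_Rn n) (\<Union>B\<in>P. B \<inter> {x. x i < c}) = (\<Sum>B\<in>P. measure (lborel_Rn n) (B \<inter> {x. x i < c}))"
      proof (rule measure_finite_Union)
        show "disjoint_family_on (\<lambda>B. B \<inter> {x. x i < c}) P"
          using P unfolding box_family_def disjoint_def disjoint_family_on_def by blast
        show "(\<lambda>B. B \<inter> {x. x i < c}) ` P \<subseteq> sets (lborel_Rn n)"
          using fm by blast
        show "emeasure (lborel_Rn n) (B \<inter> {x. x i < c}) \<noteq> \<infinity>" if "B \<in> P" for B
          using fmeasurableD2[OF fm[OF that]] by simp
      qed fact
      moreover have "\<Union>P \<inter> {x. x i < c} = (\<Union>B\<in>P. B \<inter> {x. x i < c})" by auto
      ultimately show ?thesis by (simp only:)
    qed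
    moreover have "continuous_on {- m..m + 1} (\<lambda>c. measure (lborel_Rn n) (B \<inter> {x. x i < c}))" if "B \<in> P" for B
    proof -
      obtain l u where B: "B = half_open_box n l u" using box \<open>B \<in> P\<close> by blast
      have "continuous_on {- m..m + 1} (\<lambda>c. max 0 ((u(i := min (u i) c)) j - l j))" for j
        by (cases "j = i") (auto intro!: continuous_intros)
      then show ?thesis
        using \<open>i < n\<close> by (simp add: B half_open_box_cut measure_half_open_box continuous_on_prod)
    qed
    ultimately show ?thesis
      by (simp add: continuous_on_sum)
  qed
  \<comment> \<open>The upper end is \<open>m + 1\<close> because the half-space is given by a
    strict inequality: the bound \<open>m\<close> on a coordinate does not place it strictly below
    \<open>m\<close>.\<close>
  have "\<Union>P \<inter> {x. x i < - m} = {}" "\<Union>P \<inter> {x. x i < m + 1} = \<Union>P"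
    using m(2) by fastforce+
  then have "?f (- m) \<le> \<theta> * measure (lborel_Rn n) (\<Union>P)" "\<theta> * measure (lborel_Rn n) (\<Union>P) \<le> ?f (m + 1)"
    using \<theta> by (simp_all add: mult_left_le_one_le)
  then show thesis
    using IVT'[OF _ _ _ cont] m(1) that by force
qed

lemma box_family_minkowski_sum_fmeasurable:
  assumes "box_family n P" "box_family n Q"
  shows "minkowski_sum n (\<Union>P) (\<Union>Q) \<in> fmeasurable (lborel_Rn n)"
  unfolding minkowski_sum_Union using assms
  by (intro fmeasurable.finite_UN) (auto simp: box_family_def subset_iff intro!: half_open_boxes_fmeasurable minkowski_sum_boxes)

text \<open>
  The hyperplane separates two boxes of \<open>P\<close>; it is matched with the parallel one cutting \<open>\<Union>Q\<close> in the
  same proportion, so that the sums of corresponding halves lie on different sides of a third hyperplane.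
\<close>
lemma brunn_minkowski_cut:
  assumes "n > 0" and P: "box_family n P" "card P \<ge> 2" and Q: "box_family n Q" "Q \<noteq> {}"
    and IH: "\<And>P' Q'. box_family n P' \<Longrightarrow> P' \<noteq> {} \<Longrightarrow> box_family n Q' \<Longrightarrow> Q' \<noteq> {} \<Longrightarrow>
      card P' < card P \<Longrightarrow> card Q' \<le> card Q \<Longrightarrow>
      root n (measure (lborel_Rn n) (\<Union>P')) + root n (measure (lborel_Rn n) (\<Union>Q'))
        \<le> root n (measure (lborel_Rn n) (minkowski_sum n (\<Union>P') (\<Union>Q')))"
  shows "root n (measure (lborel_Rn n) (\<Union>P)) + root n (measure (lborel_Rn n) (\<Union>Q))
        \<le> root n (measure (lborel_Rn n) (minkowski_sum n (\<Union>P) (\<Union>Q)))"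
proof -
  let ?\<mu> = "measure (lborel_Rn n)"
  define p q where "p = ?\<mu> (\<Union>P)" and "q = ?\<mu> (\<Union>Q)"
  obtain B C where BC: "B \<in> P" "C \<in> P" "B \<noteq> C"
    using P(2) by (metis One_nat_def card_le_Suc0_iff_eq not_less_eq_eq numeral_2_eq_2 card.infinite zero_le)
  have box: "B \<in> half_open_boxes n" "C \<in> half_open_boxes n" and "B \<inter> C = {}"
    using P(1) BC by (auto simp: box_family_def disjoint_def)
  then obtain i c where "i < n" and
    sep: "(B \<subseteq> {x. x i < c} \<and> C \<subseteq> {x. c \<le> x i}) \<or> (C \<subseteq> {x. x i < c} \<and> B \<subseteq> {x. c \<le> x i})"
    by (rule disjoint_boxes_separated)
  then obtain D E where DE: "D \<in> P" "E \<in> P" "D \<subseteq> {x. x i < c}" "E \<subseteq> {x. c \<le> x i}" "D \<noteq> {}" "E \<noteq> {}"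
    using BC box half_open_boxes_nonempty by meson
  obtain P1 P2 where P1: "box_family n P1" "\<Union>P1 = \<Union>P \<inter> {x. x i < c}" "card P1 < card P"
    and P2: "box_family n P2" "\<Union>P2 = \<Union>P \<inter> {x. c \<le> x i}" "card P2 < card P"
  proof (rule box_family_cut[OF P(1) \<open>i < n\<close>, of c])
    fix Q R assume *: "box_family n Q" "\<Union>Q = \<Union>P \<inter> {x. x i < c}" "box_family n R" "\<Union>R = \<Union>P \<inter> {x. c \<le> x i}"
      "(\<exists>B\<in>P. B \<inter> {x. x i < c} = {}) \<Longrightarrow> card Q < card P"
      "(\<exists>B\<in>P. B \<inter> {x. c \<le> x i} = {}) \<Longrightarrow> card R < card P"
    \<comment> \<open>Each half of \<open>P\<close> loses a box, namely \<open>E\<close> below and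
      \<open>D\<close> above the hyperplane. The halves of \<open>Q\<close> need not lose any, so
      the induction hypothesis asks for a strict drop in the first family only.\<close>
    have "E \<inter> {x. x i < c} = {}" "D \<inter> {x. c \<le> x i} = {}"
      using DE by force+
    then show thesis
      using * DE that by blast
  qed
  have "P1 \<noteq> {}" "P2 \<noteq> {}"
    using DE P1(2) P2(2) by blast+
  have split: "?\<mu> (A \<union> A') = ?\<mu> A + ?\<mu> A'"
    if "A \<in> fmeasurable (lborel_Rn n)" "A' \<in> fmeasurable (lborel_Rn n)" "A \<subseteq> {x. x i < d}" "A' \<subseteq> {x. d \<le> x i}" for A A' d
    using that by (intro measure_Union) (auto dest: fmeasurableD2, force)
  have p12: "p = ?\<mu> (\<Union>P1) + ?\<mu> (\<Union>P2)"
  proof -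
    have "\<Union>P = \<Union>P1 \<union> \<Union>P2" using P1(2) P2(2) by force
    moreover have "?\<mu> (\<Union>P1 \<union> \<Union>P2) = ?\<mu> (\<Union>P1) + ?\<mu> (\<Union>P2)"
      using P1 P2 by (intro split box_family_fmeasurable) auto
    ultimately show ?thesis
      by (simp only: p_def)
  qed
  have pos: "p > 0" "q > 0" "?\<mu> (\<Union>P1) > 0" "?\<mu> (\<Union>P2) > 0"
    using box_family_measure_pos P Q P1(1) P2(1) \<open>P1 \<noteq> {}\<close> \<open>P2 \<noteq> {}\<close> DE(1) unfolding p_def q_def by blast+
  define \<theta> where "\<theta> = ?\<mu> (\<Union>P1) / p"
  have \<theta>: "0 < \<theta>" "\<theta> < 1" and \<theta>p: "?\<mu> (\<Union>P1) = \<theta> * p" "?\<mu> (\<Union>P2) = (1 - \<theta>) * p"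
    using pos p12 by (auto simp: \<theta>_def field_simps)
  obtain d where d: "?\<mu> (\<Union>Q \<inter> {x. x i < d}) = \<theta> * q"
    using box_family_bisect[OF Q \<open>i < n\<close> \<theta>] unfolding q_def by blast
  obtain Q1 Q2 where Q1: "box_family n Q1" "\<Union>Q1 = \<Union>Q \<inter> {x. x i < d}" "card Q1 \<le> card Q"
    and Q2: "box_family n Q2" "\<Union>Q2 = \<Union>Q \<inter> {x. d \<le> x i}" "card Q2 \<le> card Q"
    by (rule box_family_cut[OF Q(1) \<open>i < n\<close>, of d])
  have \<theta>q1: "?\<mu> (\<Union>Q1) = \<theta> * q" by (simp add: Q1 d)
  have "q = ?\<mu> (\<Union>Q1) + ?\<mu> (\<Union>Q2)"
  proof -
    have "\<Union>Q = \<Union>Q1 \<union> \<Union>Q2" using Q1(2) Q2(2) by force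
    moreover have "?\<mu> (\<Union>Q1 \<union> \<Union>Q2) = ?\<mu> (\<Union>Q1) + ?\<mu> (\<Union>Q2)"
      using Q1 Q2 by (intro split box_family_fmeasurable) auto
    ultimately show ?thesis
      by (simp only: q_def)
  qed
  with \<theta>q1 have \<theta>q2: "?\<mu> (\<Union>Q2) = (1 - \<theta>) * q" by (simp add: algebra_simps)
  have "Q1 \<noteq> {}" "Q2 \<noteq> {}"
    using \<theta>q1 \<theta>q2 \<theta> pos by auto
  \<comment> \<open>Homogeneity: if both volumes are multiplied by \<eta>, the sum of their roots is
    multiplied by \<open>root n \<eta>\<close>, and its \<open>n\<close>-th power by \<eta>. The
    factors \<theta> and \<open>1 - \<theta>\<close> of the two halves then add up to 1.\<close>
  have key: "\<eta> * (root n p + root n q) ^ n \<le> ?\<mu> (minkowski_sum n (\<Union>P') (\<Union>Q'))"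
    if "root n (?\<mu> (\<Union>P')) + root n (?\<mu> (\<Union>Q')) \<le> root n (?\<mu> (minkowski_sum n (\<Union>P') (\<Union>Q')))"
      "?\<mu> (\<Union>P') = \<eta> * p" "?\<mu> (\<Union>Q') = \<eta> * q" "\<eta> > 0" for P' Q' \<eta>
  proof -
    have "root n \<eta> * (root n p + root n q) \<le> root n (?\<mu> (minkowski_sum n (\<Union>P') (\<Union>Q')))"
      using that \<open>n > 0\<close> by (simp add: real_root_mult algebra_simps)
    then have "(root n \<eta> * (root n p + root n q)) ^ n \<le> root n (?\<mu> (minkowski_sum n (\<Union>P') (\<Union>Q'))) ^ n"
      using that pos \<open>n > 0\<close> by (intro power_mono) auto
    then show ?thesis
      using that \<open>n > 0\<close> by (simp add: power_mult_distrib)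
  qed
  let ?S1 = "minkowski_sum n (\<Union>P1) (\<Union>Q1)" and ?S2 = "minkowski_sum n (\<Union>P2) (\<Union>Q2)"
  have "(root n p + root n q) ^ n = \<theta> * (root n p + root n q) ^ n + (1 - \<theta>) * (root n p + root n q) ^ n"
    by (simp add: algebra_simps)
  also have "\<dots> \<le> ?\<mu> ?S1 + ?\<mu> ?S2"
    using IH[OF P1(1) \<open>P1 \<noteq> {}\<close> Q1(1) \<open>Q1 \<noteq> {}\<close> P1(3) Q1(3)]
      IH[OF P2(1) \<open>P2 \<noteq> {}\<close> Q2(1) \<open>Q2 \<noteq> {}\<close> P2(3) Q2(3)] \<theta> \<theta>p \<theta>q1 \<theta>q2
    by (intro add_mono key) auto
  also have "\<dots> = ?\<mu> (?S1 \<union> ?S2)"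
  proof (rule split[symmetric])
    show "?S1 \<subseteq> {x. x i < c + d}" "?S2 \<subseteq> {x. c + d \<le> x i}"
      using \<open>i < n\<close> by (auto simp: minkowski_sum_def P1(2) P2(2) Q1(2) Q2(2))
  qed (intro box_family_minkowski_sum_fmeasurable P1 P2 Q1 Q2)+
  also have "\<dots> \<le> ?\<mu> (minkowski_sum n (\<Union>P) (\<Union>Q))"
  proof (rule measure_mono_fmeasurable)
    have "?S1 \<subseteq> minkowski_sum n (\<Union>P) (\<Union>Q)" "?S2 \<subseteq> minkowski_sum n (\<Union>P) (\<Union>Q)"
      unfolding P1 P2 Q1 Q2 by (intro minkowski_sum_mono; blast)+
    then show "?S1 \<union> ?S2 \<subseteq> minkowski_sum n (\<Union>P) (\<Union>Q)" by blast
    show "?S1 \<union> ?S2 \<in> sets (lborel_Rn n)"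
      using P1 P2 Q1 Q2 by (intro sets.Un fmeasurableD box_family_minkowski_sum_fmeasurable)
  qed (use P Q box_family_minkowski_sum_fmeasurable in auto)
  finally have "root n ((root n p + root n q) ^ n) \<le> root n (?\<mu> (minkowski_sum n (\<Union>P) (\<Union>Q)))"
    using \<open>n > 0\<close> by simp
  moreover have "root n ((root n p + root n q) ^ n) = root n p + root n q"
    using \<open>n > 0\<close> pos by (intro real_root_power_cancel) auto
  ultimately show ?thesis
    by (simp add: p_def q_def)
qed

text \<open>Induction on the total number of boxes. A family with at least two boxes is cut, after
  exchanging the summands if it is the second one; two single boxes are settled by
  \<open>root_prod_add\<close> on their side lengths.\<close>

theorem brunn_minkowski_boxes:
  assumes "n > 0" "box_family n P" "P \<noteq> {}" "box_family n Q" "Q \<noteq> {}"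
  shows "root n (measure (lborel_Rn n) (\<Union>P)) + root n (measure (lborel_Rn n) (\<Union>Q))
        \<le> root n (measure (lborel_Rn n) (minkowski_sum n (\<Union>P) (\<Union>Q)))"
  using assms(2-)
proof (induction "card P + card Q" arbitrary: P Q rule: less_induct)
  case less
  have card: "card P > 0" "card Q > 0"
    using less.prems by (auto simp: box_family_def card_gt_0_iff)
  consider "card P \<ge> 2" | "card Q \<ge> 2" | "card P = 1" "card Q = 1"
    using card by linarith
  then show ?case
  proof cases
    case 1
    show ?thesis
      by (rule brunn_minkowski_cut[OF \<open>n > 0\<close> less.prems(1) 1 less.prems(3,4)], rule less.hyps) auto
  next
    case 2
    have "root n (measure (lborel_Rn n) (\<Union>Q)) + root n (measure (lborel_Rn n) (\<Union>P))
        \<le> root n (measure (lborel_Rn n) (minkowski_sum n (\<Union>Q) (\<Union>P)))"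
      by (rule brunn_minkowski_cut[OF \<open>n > 0\<close> less.prems(3) 2 less.prems(1,2)], rule less.hyps) auto
    then show ?thesis
      by (simp add: minkowski_sum_commute[of n "\<Union>P"] add.commute)
  next
    case 3
    then obtain B C where PQ: "P = {B}" "Q = {C}"
      by (auto simp: card_1_singleton_iff)
    then obtain l u l' u' where B: "B = half_open_box n l u" and C: "C = half_open_box n l' u'"
      and lt: "\<forall>i<n. l i < u i" "\<forall>i<n. l' i < u' i"
      using less.prems by (auto simp: box_family_def half_open_boxes_def)
    have "root n (\<Prod>i<n. u i - l i) + root n (\<Prod>i<n. u' i - l' i) \<le> root n (\<Prod>i<n. (u i - l i) + (u' i - l' i))"
      using lt \<open>n > 0\<close> by (intro root_prod_add) auto
    moreover have "(\<Prod>i<n. max 0 (u i - l i)) = (\<Prod>i<n. u i - l i)"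
      "(\<Prod>i<n. max 0 (u' i - l' i)) = (\<Prod>i<n. u' i - l' i)"
      using lt by (auto intro!: prod.cong simp: max_def dest: less_imp_le)
    moreover have "(\<Prod>i<n. max 0 (u i + u' i - (l i + l' i))) = (\<Prod>i<n. (u i - l i) + (u' i - l' i))"
    proof (rule prod.cong)
      fix i assume "i \<in> {..<n}"
      then have "l i < u i" "l' i < u' i" using lt by auto
      then show "max 0 (u i + u' i - (l i + l' i)) = (u i - l i) + (u' i - l' i)" by linarith
    qed simp
    moreover have "minkowski_sum n B C = half_open_box n (\<lambda>i. l i + l' i) (\<lambda>i. u i + u' i)"
      unfolding B C by (rule minkowski_sum_half_open_box[OF lt])
    moreover have "\<Union>P = B" "\<Union>Q = C"
      by (simp_all add: PQ)
    ultimately show ?thesis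
      by (simp only: B C measure_half_open_box)
  qed
qed

section \<open>Sets with connected boundaries\<close>

lemma connectedin_subset_or_disjoint:
  "connectedin X S \<Longrightarrow> S \<inter> X frontier_of A = {} \<Longrightarrow> S \<subseteq> A \<or> S \<inter> A = {}"
  using connectedin_Int_frontier_of by blast

text \<open>Each connected frontier lies inside the other set or misses it, which leaves four cases.
  In each of them one of the sets \<open>A \<inter> B\<close>, \<open>A - B\<close>,
  \<open>B - A\<close>, \<open>A \<union> B\<close> has empty frontier and is therefore empty or the
  whole space.\<close>

lemma closed_connected_frontiers_nested:
  assumes X: "connected_space X" and A: "closedin X A" and B: "closedin X B" and AB: "A \<union> B \<noteq> topspace X"
    and connA: "connectedin X (X frontier_of A)" and connB: "connectedin X (X frontier_of B)"
    and disj: "X frontier_of A \<inter> X frontier_of B = {}"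
  shows "A \<inter> B = {} \<or> A \<subseteq> B \<or> B \<subseteq> A"
proof -
  have sub: "A \<subseteq> topspace X" "B \<subseteq> topspace X"
    using A B closedin_subset by auto
  have clopen: "S = {} \<or> S = topspace X" if "S \<subseteq> topspace X" "X frontier_of S = {}" for S
    using X connected_space_frontier_eq_empty that by blast
  have interior: "x \<in> X interior_of C" if "x \<in> C" "closedin X C" "x \<notin> X frontier_of C" for x C
    using that by (simp add: frontier_of_def closure_of_closedin)
  \<comment> \<open>A frontier point of \<open>D - C\<close> lies in \<open>D\<close> and on the
    frontier of \<open>D\<close> or of \<open>C\<close>. The latter misses \<open>D\<close>; the
    former lies in the interior of \<open>C\<close>, which the closure of \<open>D - C\<close> does
    not meet.\<close>
  have diff: "D \<subseteq> C" if C: "closedin X C" and D: "closedin X D" and "C \<noteq> topspace X" "D \<noteq> topspace X"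
      and "X frontier_of D \<subseteq> C" "X frontier_of C \<inter> D = {}" "X frontier_of C \<inter> X frontier_of D = {}" for C D
  proof -
    have "D \<subseteq> topspace X" using D closedin_subset by auto
    have "X closure_of (D - C) \<subseteq> D"
      using D by (simp add: closure_of_minimal)
    moreover have "X closure_of (D - C) \<inter> X interior_of C = {}"
      using interior_of_subset[of X C] by (subst Int_commute) (auto simp: openin_Int_closure_of_eq_empty)
    moreover have "X frontier_of D \<subseteq> X interior_of C"
      using that interior by blast
    moreover have "X frontier_of (D - C) \<subseteq> X closure_of (D - C) \<inter> (X frontier_of D \<union> X frontier_of C)"
    proof -
      have "D \<inter> (topspace X - C) = D - C"
        using \<open>D \<subseteq> topspace X\<close> by blast
      then show ?thesis
        using frontier_of_Int[of X D "topspace X - C"] by (simp add: frontier_of_complement)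
    qed
    ultimately have "X frontier_of (D - C) = {}"
      using that by blast
    then show ?thesis
      using clopen[of "D - C"] \<open>D \<subseteq> topspace X\<close> that by blast
  qed
  consider "X frontier_of A \<inter> B = {}" "X frontier_of B \<inter> A = {}"
    | "X frontier_of A \<subseteq> B" "X frontier_of B \<inter> A = {}"
    | "X frontier_of A \<inter> B = {}" "X frontier_of B \<subseteq> A"
    | "X frontier_of A \<subseteq> B" "X frontier_of B \<subseteq> A"
    using connectedin_subset_or_disjoint[OF connA disj]
      connectedin_subset_or_disjoint[OF connB, of A] disj by blast
  then show ?thesis
  proof cases
    case 1
    have "X frontier_of (A \<inter> B) = (A \<inter> B) \<inter> (X frontier_of A \<union> X frontier_of B)"
      using A B by (simp add: frontier_of_Int closedin_Int closure_of_closedin)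
    then have "X frontier_of (A \<inter> B) = {}"
      using 1 by blast
    then show ?thesis
      using clopen[of "A \<inter> B"] sub AB by blast
  next
    case 2
    then have "A \<subseteq> B"
      using diff[of B A] A B sub AB disj by blast
    then show ?thesis by blast
  next
    case 3
    then have "B \<subseteq> A"
      using diff[of A B] A B sub AB disj by blast
    then show ?thesis by blast
  next
    case 4
    \<comment> \<open>Each frontier lies in the other set but off that set's frontier, hence in its
      interior, so no frontier point of either set remains on the frontier of the union.\<close>
    have "X frontier_of A \<subseteq> X interior_of (A \<union> B)" "X frontier_of B \<subseteq> X interior_of (A \<union> B)"
      using 4 disj interior[OF _ A] interior[OF _ B] interior_of_mono[of A "A \<union> B" X] interior_of_mono[of B "A \<union> B" X]
      by blast+
    moreover have "X frontier_of (A \<union> B) \<subseteq> X frontier_of A \<union> X frontier_of B"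
      by (rule frontier_of_Un_subset)
    moreover have "X frontier_of (A \<union> B) \<inter> X interior_of (A \<union> B) = {}"
      by (auto simp: frontier_of_def)
    ultimately have "X frontier_of (A \<union> B) = {}"
      by blast
    then show ?thesis
      using clopen[of "A \<union> B"] sub AB by blast
  qed
qed

section \<open>The topology of real n-space: compact sets, sums and reflections\<close>

lemma topspace_Rn [simp]: "topspace (Rn_topology n) = extensional {..<n}"
  by (auto simp: Rn_topology_def PiE_def)

lemma Hausdorff_space_Rn: "Hausdorff_space (Rn_topology n)"
  by (auto simp: Rn_topology_def Hausdorff_space_product_topology)

lemma connected_space_Rn: "connected_space (Rn_topology n)"
  using connectedin_topspace[of euclideanreal]
  by (auto simp: Rn_topology_def connected_space_product_topology)

lemma continuous_map_into_Rn:
  "continuous_map X (Rn_topology n) f \<longleftrightarrow>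
    f \<in> topspace X \<rightarrow> extensional {..<n} \<and> (\<forall>i<n. continuous_map X euclideanreal (\<lambda>x. f x i))"
  by (auto simp: Rn_topology_def continuous_map_componentwise)

lemma continuous_map_Rn_component: "i < n \<Longrightarrow> continuous_map (Rn_topology n) euclideanreal (\<lambda>x. x i)"
  by (auto simp: Rn_topology_def intro: continuous_map_product_projection)

lemma not_compact_space_Rn:
  assumes "n > 0" shows "\<not> compact_space (Rn_topology n)"
  using assms by (auto simp: Rn_topology_def compact_space_product_topology product_topology_trivial_iff)

lemma compactin_Rn_closedin: "compactin (Rn_topology n) K \<Longrightarrow> closedin (Rn_topology n) K"
  by (simp add: Hausdorff_space_Rn compactin_imp_closedin)

lemma compactin_Rn_extensional: "compactin (Rn_topology n) K \<Longrightarrow> K \<subseteq> extensional {..<n}"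
  using compactin_subset_topspace by fastforce

lemma compactin_Rn_frontier_of:
  assumes "compactin (Rn_topology n) K"
  shows "compactin (Rn_topology n) (Rn_topology n frontier_of K)"
  using assms compactin_Rn_closedin
  by (intro closed_compactin[OF assms]) (auto simp: closedin_frontier_of frontier_of_subset_closedin)

lemma compactin_minkowski_sum:
  assumes "compactin (Rn_topology n) K" "compactin (Rn_topology n) T"
  shows "compactin (Rn_topology n) (minkowski_sum n K T)"
proof -
  let ?f = "\<lambda>p::(nat \<Rightarrow> real) \<times> (nat \<Rightarrow> real). \<lambda>i\<in>{..<n}. fst p i + snd p i"
  have "continuous_map (prod_topology (Rn_topology n) (Rn_topology n)) (Rn_topology n) ?f"
    using continuous_map_Rn_component[of _ n]
    by (auto simp: continuous_map_into_Rn continuous_map_of_fst continuous_map_of_snd intro!: continuous_map_add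
       continuous_map_compose[OF continuous_map_fst, unfolded o_def] continuous_map_compose[OF continuous_map_snd, unfolded o_def])
  then have "compactin (Rn_topology n) (?f ` (K \<times> T))"
    using assms by (intro image_compactin) (auto simp: compactin_Times)
  moreover have "?f ` (K \<times> T) = minkowski_sum n K T"
    by (force simp: minkowski_sum_def)
  ultimately show ?thesis by simp
qed

text \<open>The map is a continuous involution on the carrier. It carries \<open>T\<close> to
  \<open>x - T\<close> and the frontier of \<open>T\<close> to the frontier of
  \<open>x - T\<close>.\<close>

lemma homeomorphic_map_Rn_reflect:
  "homeomorphic_map (Rn_topology n) (Rn_topology n) (\<lambda>y. \<lambda>i\<in>{..<n}. x i - y i)"
proof -
  let ?f = "\<lambda>y. \<lambda>i\<in>{..<n}. x i - y i"
  have "continuous_map (Rn_topology n) (Rn_topology n) ?f"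
    by (auto simp: continuous_map_into_Rn intro!: continuous_map_diff continuous_map_Rn_component)
  moreover have "?f (?f y) = y" if "y \<in> extensional {..<n}" for y
    using that by (auto simp: extensional_def)
  ultimately have "homeomorphic_maps (Rn_topology n) (Rn_topology n) ?f ?f"
    by (auto simp: homeomorphic_maps_def)
  then show ?thesis by (rule homeomorphic_maps_imp_map)
qed

text \<open>This is the set of \<open>x\<close> with \<open>x - T \<subseteq> K\<close>, in other
  words the usual Minkowski difference (erosion) of \<open>K\<close> by the reflected set
  \<open>- T\<close>.\<close>

definition minkowski_diff :: "nat \<Rightarrow> (nat \<Rightarrow> real) set \<Rightarrow> (nat \<Rightarrow> real) set \<Rightarrow> (nat \<Rightarrow> real) set" where
  "minkowski_diff n K T = {x \<in> extensional {..<n}. \<forall>t\<in>T. (\<lambda>i\<in>{..<n}. x i - t i) \<in> K}"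

text \<open>The set is closed, as an intersection of preimages of \<open>K\<close> under
  translations, and any single point of \<open>T\<close> shows that it lies in the compact set
  \<open>K + T\<close>. For empty \<open>T\<close> it would be the whole space.\<close>

lemma compactin_minkowski_diff:
  assumes K: "compactin (Rn_topology n) K" and T: "compactin (Rn_topology n) T" "T \<noteq> {}"
  shows "compactin (Rn_topology n) (minkowski_diff n K T)"
proof (rule closed_compactin)
  show "compactin (Rn_topology n) (minkowski_sum n K T)"
    using K T by (intro compactin_minkowski_sum)
  show "minkowski_diff n K T \<subseteq> minkowski_sum n K T"
  proof
    fix x assume x: "x \<in> minkowski_diff n K T"
    obtain t where "t \<in> T" using T by blast
    then have "(\<lambda>i\<in>{..<n}. x i - t i) \<in> K" "x \<in> extensional {..<n}"
      using x by (auto simp: minkowski_diff_def)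
    then show "x \<in> minkowski_sum n K T"
      using \<open>t \<in> T\<close> unfolding minkowski_sum_def
      by (intro CollectI exI[of _ "\<lambda>i\<in>{..<n}. x i - t i"] exI[of _ t]) (auto simp: extensional_def)
  qed
  have "continuous_map (Rn_topology n) (Rn_topology n) (\<lambda>x. \<lambda>i\<in>{..<n}. x i - t i)" for t
    by (auto simp: continuous_map_into_Rn intro!: continuous_map_diff continuous_map_Rn_component)
  from closedin_continuous_map_preimage[OF this compactin_Rn_closedin[OF K]] have "closedin (Rn_topology n) (\<Inter>t\<in>T. {x \<in> topspace (Rn_topology n). (\<lambda>i\<in>{..<n}. x i - t i) \<in> K})"
    using T by (intro closedin_INT) auto
  moreover have "(\<Inter>t\<in>T. {x \<in> topspace (Rn_topology n). (\<lambda>i\<in>{..<n}. x i - t i) \<in> K}) = minkowski_diff n K T"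
    using T by (auto simp: minkowski_diff_def)
  ultimately show "closedin (Rn_topology n) (minkowski_diff n K T)" by simp
qed

lemma minkowski_sum_subset_frontiers:
  assumes "n > 0" and K: "compactin (Rn_topology n) K" and T: "compactin (Rn_topology n) T"
    and conn: "connectedin (Rn_topology n) (Rn_topology n frontier_of K)"
      "connectedin (Rn_topology n) (Rn_topology n frontier_of T)"
  shows "minkowski_sum n K T \<subseteq>
    minkowski_sum n (Rn_topology n frontier_of K) (Rn_topology n frontier_of T) \<union>
    minkowski_diff n K T \<union> minkowski_diff n T K"
proof
  let ?X = "Rn_topology n"
  fix x assume x: "x \<in> minkowski_sum n K T"
  let ?f = "\<lambda>y. \<lambda>i\<in>{..<n}. x i - y i"
  have sub: "K \<subseteq> extensional {..<n}" "T \<subseteq> extensional {..<n}"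
    using K T by (auto dest: compactin_Rn_extensional)
  have xext: "x \<in> extensional {..<n}"
    using x by (auto simp: minkowski_sum_def)
  have ff: "?f (?f y) = y" if "y \<in> extensional {..<n}" for y
    using that by (auto simp: extensional_def)
  have hom: "homeomorphic_map ?X ?X ?f" by (rule homeomorphic_map_Rn_reflect)
  have R: "compactin ?X (?f ` T)"
    using T hom homeomorphic_imp_continuous_map by (intro image_compactin)
  have frR: "?X frontier_of (?f ` T) = ?f ` (?X frontier_of T)"
    using sub by (intro homeomorphic_map_frontier_of[OF hom]) auto
  have sumI: "x \<in> minkowski_sum n A B" if "a \<in> A" "b \<in> B" "a = ?f b" for A B a b
    unfolding minkowski_sum_def using that xext
    by (intro CollectI exI[of _ a] exI[of _ b]) (auto simp: extensional_def)
  \<comment> \<open>A common point of the frontiers of \<open>K\<close> and \<open>x - T\<close> has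
    the form \<open>x - t\<close> with \<open>t\<close> on the frontier of \<open>T\<close>, which
    writes \<open>x\<close> as a sum of two frontier points.\<close>
  show "x \<in> minkowski_sum n (?X frontier_of K) (?X frontier_of T) \<union> minkowski_diff n K T \<union> minkowski_diff n T K"
  proof (cases "?X frontier_of K \<inter> ?X frontier_of (?f ` T) = {}")
    case False
    then show ?thesis
      using sumI unfolding frR by blast
  next
    case True
    \<comment> \<open>The union is compact, whereas the whole space is not, since
      \<open>n > 0\<close>.\<close>
    have "K \<union> ?f ` T \<noteq> topspace ?X"
      using compactin_Un[OF K R] not_compact_space_Rn[OF \<open>n > 0\<close>] unfolding compact_space_def by metis
    moreover have "connectedin ?X (?X frontier_of (?f ` T))"
      using conn(2) hom unfolding frR by (intro connectedin_continuous_map_image homeomorphic_imp_continuous_map)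
    ultimately have "K \<inter> ?f ` T = {} \<or> K \<subseteq> ?f ` T \<or> ?f ` T \<subseteq> K"
      using True K R conn
      by (intro closed_connected_frontiers_nested[OF connected_space_Rn]) (auto intro: compactin_Rn_closedin)
    moreover have "K \<inter> ?f ` T \<noteq> {}"
    proof -
      obtain k t where "k \<in> K" "t \<in> T" "x = (\<lambda>i\<in>{..<n}. k i + t i)"
        using x by (auto simp: minkowski_sum_def)
      then have "?f t = k"
        using sub(1) by (intro ext) (auto simp: extensional_def)
      then show ?thesis using \<open>k \<in> K\<close> \<open>t \<in> T\<close> by blast
    qed
    moreover have "x \<in> minkowski_diff n K T" if "?f ` T \<subseteq> K"
      using that xext by (auto simp: minkowski_diff_def)
    moreover have "x \<in> minkowski_diff n T K" if "K \<subseteq> ?f ` T"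
    proof -
      have "?f k \<in> T" if "k \<in> K" for k
      proof -
        obtain t where "t \<in> T" "k = ?f t"
          using \<open>K \<subseteq> ?f ` T\<close> \<open>k \<in> K\<close> by blast
        then show ?thesis
          using ff[of t] sub(2) by (simp only: subset_iff)
      qed
      then show ?thesis
        using xext by (auto simp: minkowski_diff_def)
    qed
    ultimately show ?thesis by blast
  qed
qed

section \<open>The Brunn--Minkowski inequality for compact sets\<close>

text \<open>Choosing one point for each \<open>m\<close> gives a sequence that converges to
  \<open>x\<close> coordinatewise. The rate \<open>2 / 2 ^ m\<close> suits a sum of two points that
  are each known up to \<open>1 / 2 ^ m\<close>.\<close>

lemma Rn_closedin_limit:
  assumes "closedin (Rn_topology n) L" "x \<in> extensional {..<n}"
    and "\<And>m. \<exists>s\<in>L. \<forall>i<n. \<bar>x i - s i\<bar> \<le> 2 / 2 ^ m"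
  shows "x \<in> L"
proof -
  obtain s where s: "\<And>m. s m \<in> L" "\<And>m i. i < n \<Longrightarrow> \<bar>x i - s m i\<bar> \<le> 2 / 2 ^ m"
    using assms(3) by metis
  have lim: "(\<lambda>m. 2 / 2 ^ m :: real) \<longlonglongrightarrow> 0"
    by (rule LIMSEQ_divide_realpow_zero) simp
  have "(\<lambda>m. s m i) \<longlonglongrightarrow> x i" if "i < n" for i
  proof (rule LIM_zero_cancel, rule tendsto_0_le)
    show "(\<lambda>m. 2 / 2 ^ m :: real) \<longlonglongrightarrow> 0" by (rule lim)
    show "\<forall>\<^sub>F m in sequentially. norm (s m i - x i) \<le> norm (2 / 2 ^ m :: real) * 1"
      using s(2)[OF that] by (simp add: abs_minus_commute)
  qed
  moreover have "s m \<in> extensional {..<n}" for m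
    using s(1) closedin_subset[OF assms(1)] by auto
  ultimately have "limitin (Rn_topology n) s x sequentially"
    using assms(2) by (simp add: Rn_topology_def limitin_componentwise PiE_def)
  then show ?thesis
    using limitin_closedin assms(1) s(1) by (metis eventually_sequentiallyI sequentially_bot)
qed

text \<open>The union of the half-open dyadic cubes of side \<open>1 / 2 ^ m\<close> that meet
  \<open>K\<close>: the integer parts of the scaled coordinates identify the cube of a
  point.\<close>

definition dyadic_hull :: "nat \<Rightarrow> nat \<Rightarrow> (nat \<Rightarrow> real) set \<Rightarrow> (nat \<Rightarrow> real) set" where
  "dyadic_hull n m K = {y \<in> extensional {..<n}. \<exists>k\<in>K. \<forall>i<n. \<lfloor>2 ^ m * y i\<rfloor> = \<lfloor>2 ^ m * k i\<rfloor>}"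

lemma dyadic_hull_superset: "K \<subseteq> extensional {..<n} \<Longrightarrow> K \<subseteq> dyadic_hull n m K"
  by (auto simp: dyadic_hull_def)

text \<open>Dyadic cubes are nested: halving the index of a cube and rounding down gives the index
  of the cube of the previous level that contains it.\<close>

lemma decseq_dyadic_hull: "decseq (\<lambda>m. dyadic_hull n m K)"
proof (rule decseq_SucI)
  have half: "\<lfloor>2 ^ m * y\<rfloor> = \<lfloor>2 ^ Suc m * y\<rfloor> div 2" for m and y :: real
    using floor_divide_real_eq_div[of 2 "2 ^ Suc m * y"] by simp
  show "dyadic_hull n (Suc m) K \<subseteq> dyadic_hull n m K" for m
    by (auto simp: dyadic_hull_def half[of m])
qed

lemma dyadic_hull_close:
  assumes "y \<in> dyadic_hull n m K"
  obtains k where "k \<in> K" "\<And>i. i < n \<Longrightarrow> \<bar>y i - k i\<bar> \<le> 1 / 2 ^ m"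
proof -
  obtain k where k: "k \<in> K" "\<forall>i<n. \<lfloor>2 ^ m * y i\<rfloor> = \<lfloor>2 ^ m * k i\<rfloor>"
    using assms by (auto simp: dyadic_hull_def)
  have "\<bar>y i - k i\<bar> \<le> 1 / 2 ^ m" if "i < n" for i
  proof -
    have "\<bar>a - b\<bar> \<le> 1" if "\<lfloor>a\<rfloor> = \<lfloor>b\<rfloor>" for a b :: real
      using that by linarith
    then have "\<bar>2 ^ m * y i - 2 ^ m * k i\<bar> \<le> 1"
      using k(2) that by blast
    then have "\<bar>2 ^ m * (y i - k i)\<bar> \<le> 1"
      by (simp only: right_diff_distrib)
    then have "\<bar>y i - k i\<bar> * 2 ^ m \<le> 1"
      by (simp add: abs_mult mult.commute)
    then show ?thesis
      by (simp add: pos_le_divide_eq)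
  qed
  with k(1) show thesis by (rule that)
qed

lemma compactin_Rn_bounded:
  assumes "compactin (Rn_topology n) K"
  obtains M where "\<And>x i. x \<in> K \<Longrightarrow> i < n \<Longrightarrow> \<bar>x i\<bar> \<le> M"
proof -
  have "\<exists>M. \<forall>x\<in>K. \<bar>x i\<bar> \<le> M" if "i < n" for i
  proof -
    have "compactin euclideanreal ((\<lambda>x. x i) ` K)"
      using assms continuous_map_Rn_component[OF that] by (rule image_compactin)
    then have "bounded ((\<lambda>x. x i) ` K)"
      by (simp add: compact_imp_bounded)
    then show ?thesis
      by (auto simp: bounded_iff)
  qed
  then obtain M where M: "\<And>i x. i < n \<Longrightarrow> x \<in> K \<Longrightarrow> \<bar>x i\<bar> \<le> M i"
    by metis
  have "\<bar>x i\<bar> \<le> (\<Sum>i<n. \<bar>M i\<bar>)" if "x \<in> K" "i < n" for x i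
    using M[OF that(2,1)] member_le_sum[of i "{..<n}" "\<lambda>i. \<bar>M i\<bar>"] that(2) by fastforce
  then show thesis by (rule that)
qed

lemma dyadic_hull_box_family:
  assumes K: "compactin (Rn_topology n) K"
  obtains P where "box_family n P" "\<Union>P = dyadic_hull n m K"
proof -
  define cell where "cell q = half_open_box n (\<lambda>i. of_int (q i) / 2 ^ m) (\<lambda>i. (of_int (q i) + 1) / 2 ^ m)"
    for q :: "nat \<Rightarrow> int"
  \<comment> \<open>The restriction to \<open>{..<n}\<close> makes an index depend only on the cube,
    and bounded indices then form a finite set of extensional functions.\<close>
  define ind where "ind k = (\<lambda>i\<in>{..<n}. \<lfloor>2 ^ m * k i\<rfloor>)" for k :: "nat \<Rightarrow> real"
  have mem: "y \<in> cell (ind k) \<longleftrightarrow> y \<in> extensional {..<n} \<and> (\<forall>i<n. \<lfloor>2 ^ m * y i\<rfloor> = \<lfloor>2 ^ m * k i\<rfloor>)" for y k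
  proof -
    have "\<lfloor>2 ^ m * y i\<rfloor> = q \<longleftrightarrow> of_int q / 2 ^ m \<le> y i \<and> y i < (of_int q + 1) / 2 ^ m" for i and q :: int
      by (auto simp: floor_eq_iff field_simps)
    then show ?thesis
      by (simp add: cell_def mem_half_open_box ind_def)
  qed
  let ?P = "(\<lambda>k. cell (ind k)) ` K"
  obtain M where M: "\<And>x i. x \<in> K \<Longrightarrow> i < n \<Longrightarrow> \<bar>x i\<bar> \<le> M"
    using compactin_Rn_bounded[OF K] by blast
  have "ind ` K \<subseteq> (\<Pi>\<^sub>E i\<in>{..<n}. {- \<lceil>2 ^ m * M\<rceil>..\<lceil>2 ^ m * M\<rceil>})"
  proof
    fix q assume "q \<in> ind ` K"
    then obtain k where k: "k \<in> K" "q = ind k" by blast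
    have "- \<lceil>2 ^ m * M\<rceil> \<le> \<lfloor>2 ^ m * k i\<rfloor> \<and> \<lfloor>2 ^ m * k i\<rfloor> \<le> \<lceil>2 ^ m * M\<rceil>" if "i < n" for i
    proof -
      have "\<bar>2 ^ m * k i\<bar> \<le> 2 ^ m * M"
        using M[OF k(1) that] by (simp add: abs_mult)
      then show ?thesis by linarith
    qed
    then show "q \<in> (\<Pi>\<^sub>E i\<in>{..<n}. {- \<lceil>2 ^ m * M\<rceil>..\<lceil>2 ^ m * M\<rceil>})"
      by (auto simp: k ind_def)
  qed
  then have "finite (ind ` K)"
    by (rule finite_subset) (auto intro: finite_PiE)
  then have "finite ?P"
    using finite_imageI[of "ind ` K" cell] by (simp add: image_image)
  moreover have "?P \<subseteq> half_open_boxes n"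
  proof -
    have "of_int (q i) / 2 ^ m < (of_int (q i) + 1) / (2 ^ m :: real)" for q :: "nat \<Rightarrow> int" and i
      by (rule divide_strict_right_mono) auto
    then show ?thesis
      unfolding half_open_boxes_def cell_def by blast
  qed
  moreover have "disjoint ?P"
  proof (rule disjointI)
    fix A B assume "A \<in> ?P" "B \<in> ?P" "A \<noteq> B"
    then obtain k l where kl: "A = cell (ind k)" "B = cell (ind l)" by blast
    show "A \<inter> B = {}"
    proof (rule ccontr)
      assume "A \<inter> B \<noteq> {}"
      then obtain y where "y \<in> cell (ind k)" "y \<in> cell (ind l)" using kl by blast
      then have "\<forall>i<n. \<lfloor>2 ^ m * k i\<rfloor> = \<lfloor>2 ^ m * l i\<rfloor>"
        by (simp add: mem)
      then have "ind k = ind l"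
        by (auto simp: ind_def restrict_def)
      with kl \<open>A \<noteq> B\<close> show False by simp
    qed
  qed
  moreover have "\<Union>?P = dyadic_hull n m K"
    by (auto simp: mem dyadic_hull_def)
  ultimately show thesis
    using that by (simp add: box_family_def)
qed

text \<open>Compactness refers to the product topology and measurability to the product of the
  measures. The two meet because a compact set is the intersection of its dyadic hulls, each a
  finite union of boxes.\<close>

lemma compactin_Rn_fmeasurable:
  assumes K: "compactin (Rn_topology n) K"
  shows "K \<in> fmeasurable (lborel_Rn n)"
proof -
  have fm: "dyadic_hull n m K \<in> fmeasurable (lborel_Rn n)" for m
    using dyadic_hull_box_family[OF K] box_family_fmeasurable by metis
  have "(\<Inter>m. dyadic_hull n m K) \<subseteq> K"
  proof
    fix x assume x: "x \<in> (\<Inter>m. dyadic_hull n m K)"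
    then have "x \<in> extensional {..<n}" by (auto simp: dyadic_hull_def)
    moreover have "\<exists>s\<in>K. \<forall>i<n. \<bar>x i - s i\<bar> \<le> 2 / 2 ^ m" for m
    proof -
      obtain k where k: "k \<in> K" "\<And>i. i < n \<Longrightarrow> \<bar>x i - k i\<bar> \<le> 1 / 2 ^ m"
        using x dyadic_hull_close by blast
      have "1 / 2 ^ m \<le> (2 / 2 ^ m :: real)" by (simp add: divide_right_mono)
      then show ?thesis
        using k by (meson order_trans)
    qed
    ultimately show "x \<in> K"
      using Rn_closedin_limit compactin_Rn_closedin[OF K] by blast
  qed
  moreover have "K \<subseteq> (\<Inter>m. dyadic_hull n m K)"
    using dyadic_hull_superset[OF compactin_Rn_extensional[OF K]] by blast
  ultimately have eq: "(\<Inter>m. dyadic_hull n m K) = K" by blast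
  have "(\<Inter>m. dyadic_hull n m K) \<in> sets (lborel_Rn n)"
    using fm by (intro sets.countable_INT) auto
  then have "K \<in> sets (lborel_Rn n)"
    by (simp only: eq)
  with fm[of 0] dyadic_hull_superset[OF compactin_Rn_extensional[OF K]] show ?thesis
    by (rule fmeasurableI2)
qed

text \<open>The inequality for boxes holds for the dyadic hulls, which contain \<open>K\<close> and
  \<open>T\<close>. Their sums decrease to \<open>K + T\<close>, and continuity of the measure from
  above passes the bound to the limit.\<close>

theorem brunn_minkowski:
  assumes "n > 0" and K: "compactin (Rn_topology n) K" "K \<noteq> {}" and T: "compactin (Rn_topology n) T" "T \<noteq> {}"
  shows "root n (measure (lborel_Rn n) K) + root n (measure (lborel_Rn n) T)
    \<le> root n (measure (lborel_Rn n) (minkowski_sum n K T))"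
proof -
  let ?\<mu> = "measure (lborel_Rn n)" and ?D = "\<lambda>m. minkowski_sum n (dyadic_hull n m K) (dyadic_hull n m T)"
  have KT: "K \<subseteq> extensional {..<n}" "T \<subseteq> extensional {..<n}"
    using K T compactin_Rn_extensional by auto
  have D: "?D m \<in> fmeasurable (lborel_Rn n)"
    and bound: "root n (?\<mu> K) + root n (?\<mu> T) \<le> root n (?\<mu> (?D m))" for m
  proof -
    obtain P Q where P: "box_family n P" "\<Union>P = dyadic_hull n m K" and Q: "box_family n Q" "\<Union>Q = dyadic_hull n m T"
      using dyadic_hull_box_family K(1) T(1) by metis
    have sub: "K \<subseteq> \<Union>P" "T \<subseteq> \<Union>Q"
      using P Q dyadic_hull_superset KT by auto
    then have "P \<noteq> {}" "Q \<noteq> {}"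
      using K T by auto
    then have "root n (?\<mu> (\<Union>P)) + root n (?\<mu> (\<Union>Q)) \<le> root n (?\<mu> (?D m))"
      using brunn_minkowski_boxes[OF \<open>n > 0\<close> P(1) _ Q(1)] P(2) Q(2) by simp
    moreover have "?\<mu> K \<le> ?\<mu> (\<Union>P)" "?\<mu> T \<le> ?\<mu> (\<Union>Q)"
      using sub compactin_Rn_fmeasurable K T box_family_fmeasurable P(1) Q(1)
      by (auto intro!: measure_mono_fmeasurable)
    ultimately show "root n (?\<mu> K) + root n (?\<mu> T) \<le> root n (?\<mu> (?D m))"
      using \<open>n > 0\<close> by (smt (verit) real_root_le_mono)
    show "?D m \<in> fmeasurable (lborel_Rn n)"
      using box_family_minkowski_sum_fmeasurable[OF P(1) Q(1)] P(2) Q(2) by simp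
  qed
  \<comment> \<open>A point of all the sums of hulls is within \<open>2 / 2 ^ m\<close> of
    \<open>K + T\<close> for every \<open>m\<close>, in each coordinate, and \<open>K + T\<close> is
    compact, hence closed.\<close>
  have "(\<Inter>m. ?D m) = minkowski_sum n K T"
  proof (intro equalityI subsetI)
    fix x assume x: "x \<in> (\<Inter>m. ?D m)"
    then have "x \<in> extensional {..<n}" by (auto simp: minkowski_sum_def)
    moreover have "\<exists>s\<in>minkowski_sum n K T. \<forall>i<n. \<bar>x i - s i\<bar> \<le> 2 / 2 ^ m" for m
    proof -
      obtain a b where ab: "a \<in> dyadic_hull n m K" "b \<in> dyadic_hull n m T" "x = (\<lambda>i\<in>{..<n}. a i + b i)"
        using x by (fastforce simp: minkowski_sum_def)
      obtain k where k: "k \<in> K" "\<And>i. i < n \<Longrightarrow> \<bar>a i - k i\<bar> \<le> 1 / 2 ^ m"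
        using ab(1) dyadic_hull_close by blast
      obtain t where t: "t \<in> T" "\<And>i. i < n \<Longrightarrow> \<bar>b i - t i\<bar> \<le> 1 / 2 ^ m"
        using ab(2) dyadic_hull_close by blast
      have "\<bar>x i - (k i + t i)\<bar> \<le> 2 / 2 ^ m" if "i < n" for i
        using k(2)[OF that] t(2)[OF that] that by (simp add: ab(3))
      then show ?thesis
        using k(1) t(1) by (intro bexI[of _ "\<lambda>i\<in>{..<n}. k i + t i"]) (auto simp: minkowski_sum_def)
    qed
    ultimately show "x \<in> minkowski_sum n K T"
      using Rn_closedin_limit compactin_Rn_closedin[OF compactin_minkowski_sum[OF K(1) T(1)]] by blast
  next
    fix x assume "x \<in> minkowski_sum n K T"
    then show "x \<in> (\<Inter>m. ?D m)"
      using minkowski_sum_mono[OF dyadic_hull_superset[OF KT(1)] dyadic_hull_superset[OF KT(2)]] by blast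
  qed
  moreover have "(\<lambda>m. ?\<mu> (?D m)) \<longlonglongrightarrow> ?\<mu> (\<Inter>m. ?D m)"
  proof (rule Lim_measure_decseq)
    show "decseq ?D"
      unfolding decseq_def by (intro allI impI minkowski_sum_mono decseqD[OF decseq_dyadic_hull])
  qed (use D in \<open>auto dest: fmeasurableD2\<close>)
  ultimately have "(\<lambda>m. root n (?\<mu> (?D m))) \<longlonglongrightarrow> root n (?\<mu> (minkowski_sum n K T))"
    by (auto intro: tendsto_real_root)
  then show ?thesis
    using bound by (intro LIMSEQ_le_const) auto
qed

text \<open>The product measure is determined by its values on products of measurable sets, and
  negation preserves \<open>lborel\<close> in each coordinate. Since the reflection is an
  involution, the image of \<open>T\<close> is also its preimage.\<close>

lemma measure_Rn_reflect:
  assumes "T \<in> sets (lborel_Rn n)"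
  shows "measure (lborel_Rn n) ((\<lambda>y. \<lambda>i\<in>{..<n}. - y i) ` T) = measure (lborel_Rn n) T"
proof -
  let ?f = "\<lambda>y::nat \<Rightarrow> real. \<lambda>i\<in>{..<n}. - y i"
  interpret product_sigma_finite "\<lambda>_::nat. lborel :: real measure"
    by (simp add: product_sigma_finite_def sigma_finite_lborel)
  have meas: "?f \<in> measurable (lborel_Rn n) (lborel_Rn n)"
    by measurable
  have "distr (lborel_Rn n) (lborel_Rn n) ?f = lborel_Rn n"
  proof (rule PiM_eqI)
    fix A :: "nat \<Rightarrow> real set" assume A: "\<And>i. i \<in> {..<n} \<Longrightarrow> A i \<in> sets lborel"
    have 1: "uminus -` A i \<in> sets borel" if "i < n" for i
      using measurable_sets[of uminus borel borel "A i"] A[of i] that by simp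
    have 2: "emeasure lborel (uminus -` A i) = emeasure lborel (A i)" if "i < n" for i
      using A[of i] that lborel_distr_uminus emeasure_distr[of uminus lborel borel "A i"] by simp
    have "?f -` Pi\<^sub>E {..<n} A \<inter> space (lborel_Rn n) = (\<Pi>\<^sub>E i\<in>{..<n}. uminus -` A i)"
      by (auto simp: space_PiM PiE_iff)
    then have "emeasure (distr (lborel_Rn n) (lborel_Rn n) ?f) (Pi\<^sub>E {..<n} A)
        = emeasure (lborel_Rn n) (\<Pi>\<^sub>E i\<in>{..<n}. uminus -` A i)"
      using A meas by (subst emeasure_distr) (auto intro!: sets_PiM_I_finite)
    also have "\<dots> = (\<Prod>i<n. emeasure lborel (A i))"
      using 1 2 by (subst emeasure_PiM) auto
    finally show "emeasure (distr (lborel_Rn n) (lborel_Rn n) ?f) (Pi\<^sub>E {..<n} A) = (\<Prod>i<n. emeasure lborel (A i))" .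
  qed auto
  then have "measure (lborel_Rn n) T = measure (lborel_Rn n) (?f -` T \<inter> space (lborel_Rn n))"
    using measure_distr[OF meas, of T] assms by simp
  moreover have "?f -` T \<inter> space (lborel_Rn n) = ?f ` T"
  proof -
    have ext: "x \<in> extensional {..<n}" if "x \<in> T" for x
      using sets.sets_into_space[OF assms] that by (auto simp: space_PiM PiE_iff)
    have ff: "?f (?f x) = x" if "x \<in> extensional {..<n}" for x
      using that by (auto simp: extensional_def)
    show ?thesis
    proof (intro equalityI subsetI)
      fix x assume "x \<in> ?f -` T \<inter> space (lborel_Rn n)"
      then have "?f x \<in> T" "x = ?f (?f x)"
        using ff[of x] by (auto simp: space_PiM PiE_iff simp del: restrict_apply)
      then show "x \<in> ?f ` T" by blast
    next
      fix x assume "x \<in> ?f ` T"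
      then obtain t where t: "t \<in> T" "x = ?f t" by blast
      then have "?f x = t" using ff[OF ext[OF t(1)]] by simp
      then show "x \<in> ?f -` T \<inter> space (lborel_Rn n)"
        using t by (auto simp: space_PiM)
    qed
  qed
  ultimately show ?thesis by simp
qed

text \<open>Brunn--Minkowski for the difference and \<open>- T\<close>, whose sum lies in
  \<open>K\<close>. For an empty difference the inequality would claim that \<open>T\<close> is no
  larger than \<open>K\<close>.\<close>

lemma root_measure_minkowski_diff:
  assumes "n > 0" and K: "compactin (Rn_topology n) K" and T: "compactin (Rn_topology n) T" "T \<noteq> {}"
    and "minkowski_diff n K T \<noteq> {}"
  shows "root n (measure (lborel_Rn n) (minkowski_diff n K T)) + root n (measure (lborel_Rn n) T)
    \<le> root n (measure (lborel_Rn n) K)"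
proof -
  let ?f = "\<lambda>y::nat \<Rightarrow> real. \<lambda>i\<in>{..<n}. - y i"
  have "continuous_map (Rn_topology n) (Rn_topology n) ?f"
    by (auto simp: continuous_map_into_Rn intro!: continuous_map_minus continuous_map_Rn_component)
  then have fT: "compactin (Rn_topology n) (?f ` T)"
    using T(1) by (intro image_compactin)
  have E: "compactin (Rn_topology n) (minkowski_diff n K T)"
    using K T by (rule compactin_minkowski_diff)
  have "(\<lambda>i\<in>{..<n}. x i + ?f t i) = (\<lambda>i\<in>{..<n}. x i - t i)" for x t
    by (auto simp: restrict_def)
  then have "minkowski_sum n (minkowski_diff n K T) (?f ` T) \<subseteq> K"
    by (auto simp: minkowski_sum_def minkowski_diff_def simp del: restrict_apply)
  then have "measure (lborel_Rn n) (minkowski_sum n (minkowski_diff n K T) (?f ` T)) \<le> measure (lborel_Rn n) K"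
    using K E fT by (intro measure_mono_fmeasurable) (auto intro: compactin_Rn_fmeasurable fmeasurableD compactin_minkowski_sum)
  then have "root n (measure (lborel_Rn n) (minkowski_sum n (minkowski_diff n K T) (?f ` T))) \<le> root n (measure (lborel_Rn n) K)"
    using \<open>n > 0\<close> by simp
  moreover have "root n (measure (lborel_Rn n) (minkowski_diff n K T)) + root n (measure (lborel_Rn n) (?f ` T))
    \<le> root n (measure (lborel_Rn n) (minkowski_sum n (minkowski_diff n K T) (?f ` T)))"
    using assms E fT by (intro brunn_minkowski) auto
  moreover have "measure (lborel_Rn n) (?f ` T) = measure (lborel_Rn n) T"
    using compactin_Rn_fmeasurable[OF T(1)] by (intro measure_Rn_reflect) auto
  ultimately show ?thesis by simp
qed

section \<open>The volume of the sum of the boundaries\<close>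

lemma vol_compact: "compactin (Rn_topology n) K \<Longrightarrow> vol n K = measure (lborel_Rn n) K"
  by (simp add: vol_def compactin_Rn_fmeasurable fmeasurableD)

text \<open>These are the leading terms of the even and odd parts of the binomial expansion with
  exponent \<open>Suc (Suc n)\<close>: two terms of the even part, one of the odd part. The bounds
  are proved together because passing to the next power mixes the two parts.\<close>

lemma power_add_diff_bounds:
  fixes A B :: real
  assumes "0 \<le> A" "0 \<le> B"
  shows "2 * A ^ Suc (Suc n) + (Suc (Suc n)) * (Suc n) * A ^ n * B\<^sup>2 \<le> (A + B) ^ Suc (Suc n) + (A - B) ^ Suc (Suc n)"
    and "2 * (Suc (Suc n)) * A ^ Suc n * B \<le> (A + B) ^ Suc (Suc n) - (A - B) ^ Suc (Suc n)"
proof (induction n)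
  case 0
  show "2 * A ^ Suc (Suc 0) + (Suc (Suc 0)) * (Suc 0) * A ^ 0 * B\<^sup>2 \<le> (A + B) ^ Suc (Suc 0) + (A - B) ^ Suc (Suc 0)"
    "2 * (Suc (Suc 0)) * A ^ Suc 0 * B \<le> (A + B) ^ Suc (Suc 0) - (A - B) ^ Suc (Suc 0)"
    by (simp_all add: power2_eq_square algebra_simps)
next
  case (Suc n)
  let ?S = "(A + B) ^ Suc (Suc n) + (A - B) ^ Suc (Suc n)" and ?D = "(A + B) ^ Suc (Suc n) - (A - B) ^ Suc (Suc n)"
  have S: "(A + B) ^ Suc (Suc (Suc n)) + (A - B) ^ Suc (Suc (Suc n)) = A * ?S + B * ?D"
    and D: "(A + B) ^ Suc (Suc (Suc n)) - (A - B) ^ Suc (Suc (Suc n)) = A * ?D + B * ?S"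
    by (simp_all add: algebra_simps)
  have "A * (2 * A ^ Suc (Suc n) + (Suc (Suc n)) * (Suc n) * A ^ n * B\<^sup>2) + B * (2 * (Suc (Suc n)) * A ^ Suc n * B)
    \<le> A * ?S + B * ?D"
    by (rule add_mono[OF mult_left_mono[OF Suc.IH(1) assms(1)] mult_left_mono[OF Suc.IH(2) assms(2)]])
  moreover have "A * (2 * A ^ Suc (Suc n) + (Suc (Suc n)) * (Suc n) * A ^ n * B\<^sup>2) + B * (2 * (Suc (Suc n)) * A ^ Suc n * B)
     = 2 * A ^ Suc (Suc (Suc n)) + (Suc (Suc (Suc n))) * (Suc (Suc n)) * A ^ Suc n * B\<^sup>2"
    by (simp add: power2_eq_square algebra_simps)
  ultimately show "2 * A ^ Suc (Suc (Suc n)) + (Suc (Suc (Suc n))) * (Suc (Suc n)) * A ^ Suc n * B\<^sup>2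
      \<le> (A + B) ^ Suc (Suc (Suc n)) + (A - B) ^ Suc (Suc (Suc n))"
    unfolding S by linarith
  have "0 \<le> (Suc (Suc n)) * (Suc n) * A ^ n * B\<^sup>2"
    using assms by simp
  then have "2 * A ^ Suc (Suc n) \<le> ?S"
    using Suc.IH(1) by linarith
  from mult_left_mono[OF this assms(2)]
  have "A * (2 * (Suc (Suc n)) * A ^ Suc n * B) + B * (2 * A ^ Suc (Suc n)) \<le> A * ?D + B * ?S"
    by (rule add_mono[OF mult_left_mono[OF Suc.IH(2) assms(1)]])
  moreover have "A * (2 * (Suc (Suc n)) * A ^ Suc n * B) + B * (2 * A ^ Suc (Suc n)) = 2 * (Suc (Suc (Suc n))) * A ^ Suc (Suc n) * B"
    by (simp add: algebra_simps)
  ultimately show "2 * (Suc (Suc (Suc n))) * A ^ Suc (Suc n) * B \<le> (A + B) ^ Suc (Suc (Suc n)) - (A - B) ^ Suc (Suc (Suc n))"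
    unfolding D by linarith
qed

text \<open>The numerical inequality is squared to avoid the exponent \<open>n / 2\<close>. With
  \<open>A = a\<^sup>2 + b\<^sup>2\<close> and \<open>B = 2 * a * b\<close> the squares of
  \<open>a + b\<close> and \<open>a - b\<close> are \<open>A + B\<close> and \<open>A - B\<close>,
  so the right side becomes an even binomial part minus
  \<open>2 * (a\<^sup>2 - b\<^sup>2) ^ n\<close>.\<close>

lemma sum_squares_power_le:
  fixes a b :: real
  assumes n: "n \<ge> 2" and b: "0 \<le> b" "b \<le> a" and ab: "a \<le> sqrt n * b"
  shows "(a\<^sup>2 + b\<^sup>2) ^ n \<le> ((a + b) ^ n - (a - b) ^ n)\<^sup>2"
proof -
  obtain k where k: "n = Suc (Suc k)"
    using n by (metis add_2_eq_Suc le_Suc_ex)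
  define A B where "A = a\<^sup>2 + b\<^sup>2" and "B = 2 * a * b"
  have AB: "0 \<le> A" "0 \<le> B" "(a + b)\<^sup>2 = A + B" "(a - b)\<^sup>2 = A - B"
    using b by (auto simp: A_def B_def power2_eq_square algebra_simps)
  have "a\<^sup>2 \<le> n * b\<^sup>2"
    using power_mono[OF ab, of 2] b by (simp add: power_mult_distrib)
  \<comment> \<open>The hypothesis \<open>b \<le> a\<close> gives
    \<open>A \<le> 2 * a\<^sup>2\<close>; the bound on the ratio then trades one factor
    \<open>a\<^sup>2\<close> for \<open>n * b\<^sup>2\<close>.\<close>
  have "A\<^sup>2 \<le> (2 * a\<^sup>2)\<^sup>2"
    using b by (intro power_mono) (auto simp: A_def power_mono)
  also have "\<dots> = 4 * a\<^sup>2 * a\<^sup>2" by (simp add: power2_eq_square)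
  also have "\<dots> \<le> 4 * a\<^sup>2 * (n * b\<^sup>2)"
    using \<open>a\<^sup>2 \<le> n * b\<^sup>2\<close> by (intro mult_left_mono) auto
  also have "\<dots> = n * B\<^sup>2" by (simp add: B_def power2_eq_square)
  finally have A2: "A\<^sup>2 \<le> n * B\<^sup>2" .
  have diff: "a\<^sup>2 - b\<^sup>2 \<ge> 0" "(a\<^sup>2 - b\<^sup>2)\<^sup>2 = A\<^sup>2 - B\<^sup>2" "a\<^sup>2 - b\<^sup>2 \<le> A"
    using b by (auto simp: A_def B_def power2_eq_square algebra_simps mult_mono)
  have split: "x ^ n = x ^ k * x\<^sup>2" for x :: real
    by (simp add: k power2_eq_square)
  \<comment> \<open>Two of the \<open>n\<close> factors are kept exact and only the other
    \<open>k\<close> are estimated by \<open>A\<close>, which saves a term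
    \<open>A ^ k * B\<^sup>2\<close>.\<close>
  have "(a\<^sup>2 - b\<^sup>2) ^ n \<le> A ^ k * (A\<^sup>2 - B\<^sup>2)"
    unfolding split diff(2)[symmetric] using power_mono[OF diff(3,1), of k] by (rule mult_right_mono) simp
  moreover have "2 * A ^ n + n * Suc k * A ^ k * B\<^sup>2 \<le> (A + B) ^ n + (A - B) ^ n"
    using power_add_diff_bounds(1)[OF AB(1,2), of k] by (simp only: k)
  moreover have "((a + b) ^ n - (a - b) ^ n)\<^sup>2 = (A + B) ^ n + (A - B) ^ n - 2 * (a\<^sup>2 - b\<^sup>2) ^ n"
  proof -
    have "(x ^ n)\<^sup>2 = (x\<^sup>2) ^ n" for x :: real
      by (simp only: power_mult[symmetric] mult.commute)
    moreover have "(a + b) ^ n * (a - b) ^ n = (a\<^sup>2 - b\<^sup>2) ^ n"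
      by (simp add: power2_eq_square algebra_simps flip: power_mult_distrib)
    ultimately show ?thesis
      unfolding AB(3,4)[symmetric] by (simp only: power2_diff[of "(a + b) ^ n" "(a - b) ^ n"] mult.assoc)
  qed
  \<comment> \<open>The terms \<open>2 * A ^ n\<close> cancel, so only multiples of
    \<open>A ^ k * B\<^sup>2\<close> remain.\<close>
  ultimately have "((a + b) ^ n - (a - b) ^ n)\<^sup>2 \<ge> A ^ k * (real (n * Suc k) * B\<^sup>2 + 2 * B\<^sup>2)"
    by (simp add: split[of A] algebra_simps)
  also have "A ^ k * (real (n * Suc k) * B\<^sup>2 + 2 * B\<^sup>2) \<ge> A ^ k * (n * B\<^sup>2)"
  proof (intro mult_left_mono)
    have "real n \<le> real (n * Suc k) + 2" by (simp add: algebra_simps)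
    then have "real n * B\<^sup>2 \<le> (real (n * Suc k) + 2) * B\<^sup>2"
      by (intro mult_right_mono) auto
    then show "real n * B\<^sup>2 \<le> real (n * Suc k) * B\<^sup>2 + 2 * B\<^sup>2"
      by (simp add: algebra_simps)
  qed (use AB in auto)
  also have "A ^ k * (n * B\<^sup>2) \<ge> A ^ k * A\<^sup>2"
    using A2 AB by (intro mult_left_mono) auto
  finally show ?thesis
    by (simp add: split A_def)
qed

lemma measure_frontier_sum_ge:
  assumes "n > 0" and K: "compactin (Rn_topology n) K" and T: "compactin (Rn_topology n) T"
    and pos: "measure (lborel_Rn n) K > 0" "measure (lborel_Rn n) T > 0"
    and le: "measure (lborel_Rn n) T \<le> measure (lborel_Rn n) K"
    and conn: "connectedin (Rn_topology n) (Rn_topology n frontier_of K)"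
      "connectedin (Rn_topology n) (Rn_topology n frontier_of T)"
  defines "a \<equiv> root n (measure (lborel_Rn n) K)" and "b \<equiv> root n (measure (lborel_Rn n) T)"
  shows "(a + b) ^ n - (a - b) ^ n \<le>
    measure (lborel_Rn n) (minkowski_sum n (Rn_topology n frontier_of K) (Rn_topology n frontier_of T))"
proof -
  let ?\<mu> = "measure (lborel_Rn n)"
  let ?F = "minkowski_sum n (Rn_topology n frontier_of K) (Rn_topology n frontier_of T)"
  have ne: "K \<noteq> {}" "T \<noteq> {}" using pos by auto
  have ab: "0 < b" "b \<le> a" using pos le \<open>n > 0\<close> by (auto simp: a_def b_def)
  have F: "?F \<in> fmeasurable (lborel_Rn n)"
    using K T by (intro compactin_Rn_fmeasurable compactin_minkowski_sum compactin_Rn_frontier_of)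
  have diff: "minkowski_diff n K T \<in> fmeasurable (lborel_Rn n)" "minkowski_diff n T K \<in> fmeasurable (lborel_Rn n)"
    using K T ne by (auto intro!: compactin_Rn_fmeasurable compactin_minkowski_diff)
  have "?\<mu> (minkowski_diff n K T) \<le> (a - b) ^ n"
  proof (cases "minkowski_diff n K T = {}")
    case False
    then have "root n (?\<mu> (minkowski_diff n K T)) \<le> a - b"
      using root_measure_minkowski_diff[OF \<open>n > 0\<close> K T ne(2)] by (simp add: a_def b_def)
    then have "root n (?\<mu> (minkowski_diff n K T)) ^ n \<le> (a - b) ^ n"
      using \<open>n > 0\<close> by (intro power_mono) auto
    then show ?thesis using \<open>n > 0\<close> by simp
  qed (use ab in simp)
  \<comment> \<open>With the roles exchanged the root of the measure is at most
    \<open>b - a\<close>, which is not positive.\<close>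
  moreover have "?\<mu> (minkowski_diff n T K) = 0"
  proof (cases "minkowski_diff n T K = {}")
    case False
    then have "root n (?\<mu> (minkowski_diff n T K)) \<le> 0"
      using root_measure_minkowski_diff[OF \<open>n > 0\<close> T K ne(1)] ab by (simp add: a_def b_def)
    then have "?\<mu> (minkowski_diff n T K) \<le> 0" using \<open>n > 0\<close> by simp
    then show ?thesis by (simp add: measure_le_0_iff)
  qed simp
  moreover have "(a + b) ^ n \<le> ?\<mu> (minkowski_sum n K T)"
  proof -
    have "(a + b) ^ n \<le> root n (?\<mu> (minkowski_sum n K T)) ^ n"
      using brunn_minkowski[OF \<open>n > 0\<close> K ne(1) T ne(2)] ab unfolding a_def b_def by (intro power_mono) auto
    then show ?thesis using \<open>n > 0\<close> by simp
  qed
  moreover have "?\<mu> (minkowski_sum n K T) \<le> ?\<mu> (?F \<union> minkowski_diff n K T \<union> minkowski_diff n T K)"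
    using minkowski_sum_subset_frontiers[OF \<open>n > 0\<close> K T conn] F diff compactin_minkowski_sum[OF K T]
    by (intro measure_mono_fmeasurable) (auto intro: compactin_Rn_fmeasurable fmeasurableD)
  moreover have "?\<mu> (?F \<union> minkowski_diff n K T \<union> minkowski_diff n T K)
    \<le> ?\<mu> ?F + ?\<mu> (minkowski_diff n K T) + ?\<mu> (minkowski_diff n T K)"
    using F diff by (intro order_trans[OF measure_Un_le] add_mono measure_Un_le) auto
  ultimately show ?thesis by linarith
qed

text \<open>The claim is proved as \<open>(a\<^sup>2 + b\<^sup>2) ^ n \<le> ?V\<^sup>2\<close> for
  the \<open>n\<close>-th roots \<open>a\<close> and \<open>b\<close> of the volumes. The two bounds
  on the ratio are exchanged when \<open>K\<close> and \<open>T\<close> are, so the larger set may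
  take the first place.\<close>

lemma frontier_sum_vol_ge:
  assumes n: "n \<ge> 2" and K: "compactin (Rn_topology n) K" and T: "compactin (Rn_topology n) T"
    and pos: "vol n K > 0" "vol n T > 0"
    and conn: "connectedin (Rn_topology n) (Rn_topology n frontier_of K)"
      "connectedin (Rn_topology n) (Rn_topology n frontier_of T)"
    and ratio: "1 / sqrt n \<le> (vol n K / vol n T) powr (1 / n)" "(vol n K / vol n T) powr (1 / n) \<le> sqrt n"
  shows "vol n K powr (2 / n) + vol n T powr (2 / n) \<le>
    vol n (minkowski_sum n (Rn_topology n frontier_of K) (Rn_topology n frontier_of T)) powr (2 / n)"
proof -
  have "n > 0" using n by simp
  define a b where "a = root n (vol n K)" and "b = root n (vol n T)"
  let ?V = "vol n (minkowski_sum n (Rn_topology n frontier_of K) (Rn_topology n frontier_of T))"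
  have ab: "a > 0" "b > 0" using pos \<open>n > 0\<close> by (auto simp: a_def b_def)
  have ratio_eq: "(vol n K / vol n T) powr (1 / n) = a / b"
    using pos \<open>n > 0\<close> by (simp add: a_def b_def real_root_divide flip: root_powr_inverse)
  then have ratio': "b \<le> sqrt n * a" "a \<le> sqrt n * b"
    using ratio ab \<open>n > 0\<close> by (simp_all only: ratio_eq) (simp_all add: field_simps)
  note mK = vol_compact[OF K] and mT = vol_compact[OF T]
  have mF: "?V = measure (lborel_Rn n) (minkowski_sum n (Rn_topology n frontier_of K) (Rn_topology n frontier_of T))"
    using K T by (intro vol_compact compactin_minkowski_sum compactin_Rn_frontier_of)
  have "(a\<^sup>2 + b\<^sup>2) ^ n \<le> ?V\<^sup>2"
  proof (cases "b \<le> a")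
    case True
    have "vol n T \<le> vol n K" using True \<open>n > 0\<close> by (simp add: a_def b_def)
    then have "(a + b) ^ n - (a - b) ^ n \<le> ?V"
      using measure_frontier_sum_ge[OF \<open>n > 0\<close> K T _ _ _ conn] pos unfolding a_def b_def mF mK mT by blast
    moreover have "(a - b) ^ n \<le> (a + b) ^ n"
      using True ab by (intro power_mono) auto
    ultimately have "((a + b) ^ n - (a - b) ^ n)\<^sup>2 \<le> ?V\<^sup>2"
      by (intro power_mono) auto
    then show ?thesis
      using sum_squares_power_le[OF n _ True ratio'(2)] ab by linarith
  next
    case False
    then have "a \<le> b" by simp
    then have "vol n K \<le> vol n T" using \<open>n > 0\<close> by (simp add: a_def b_def)
    then have "(b + a) ^ n - (b - a) ^ n \<le> ?V"
      using measure_frontier_sum_ge[OF \<open>n > 0\<close> T K _ _ _ conn(2,1)] pos unfolding a_def b_def mF mK mT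
      by (subst minkowski_sum_commute) blast
    moreover have "(b - a) ^ n \<le> (b + a) ^ n"
      using \<open>a \<le> b\<close> ab by (intro power_mono) auto
    ultimately have "((b + a) ^ n - (b - a) ^ n)\<^sup>2 \<le> ?V\<^sup>2"
      by (intro power_mono) auto
    then show ?thesis
      using sum_squares_power_le[OF n _ \<open>a \<le> b\<close> ratio'(1)] ab by (simp add: add.commute)
  qed
  moreover have V: "?V \<ge> 0" by (simp add: mF)
  ultimately have "a\<^sup>2 + b\<^sup>2 \<le> root n (?V\<^sup>2)"
    using \<open>n > 0\<close> ab by (metis add_nonneg_nonneg real_root_le_mono real_root_power_cancel zero_le_power2)
  \<comment> \<open>The volume of the sum is only known to be nonnegative at this point; at
    \<open>x = 0\<close> both sides vanish, because \<open>0 powr y\<close> is 0.\<close>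
  moreover have sq: "x powr (2 / n) = (root n x)\<^sup>2" if "x \<ge> 0" for x :: real
    using that \<open>n > 0\<close> by (cases "x = 0") (simp_all add: root_powr_inverse powr_power)
  ultimately show ?thesis
    using V pos \<open>n > 0\<close> by (simp add: sq a_def b_def real_root_power)
qed

theorem theorem4p2:
  "(\<exists>n\<^sub>0::nat. \<forall>n\<ge>n\<^sub>0. \<forall>K T :: (nat \<Rightarrow> real) set.
      compactin (Rn_topology n) K \<longrightarrow> compactin (Rn_topology n) T \<longrightarrow>
      vol n K > 0 \<longrightarrow> vol n T > 0 \<longrightarrow>
      connectedin (Rn_topology n) (Rn_topology n frontier_of K) \<longrightarrow>
      connectedin (Rn_topology n) (Rn_topology n frontier_of T) \<longrightarrow>
      1 / sqrt (real n) \<le> (vol n K / vol n T) powr (1 / real n) \<longrightarrow>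
      (vol n K / vol n T) powr (1 / real n) \<le> sqrt (real n) \<longrightarrow>
      vol n (minkowski_sum n (Rn_topology n frontier_of K) (Rn_topology n frontier_of T)) powr (2 / real n)
        \<ge> vol n K powr (2 / real n) + vol n T powr (2 / real n))
   \<and>
   (\<exists>C::real. C > 0 \<and> (\<forall>n::nat. n \<ge> 2 \<longrightarrow> (\<forall>K T :: (nat \<Rightarrow> real) set.
      compactin (Rn_topology n) K \<longrightarrow> compactin (Rn_topology n) T \<longrightarrow>
      vol n K > 0 \<longrightarrow> vol n T > 0 \<longrightarrow>
      connectedin (Rn_topology n) (Rn_topology n frontier_of K) \<longrightarrow>
      connectedin (Rn_topology n) (Rn_topology n frontier_of T) \<longrightarrow>
      C / sqrt (real n) \<le> (vol n K / vol n T) powr (1 / real n) \<longrightarrow>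
      (vol n K / vol n T) powr (1 / real n) \<le> sqrt (real n) / C \<longrightarrow>
      vol n (minkowski_sum n (Rn_topology n frontier_of K) (Rn_topology n frontier_of T)) powr (2 / real n)
        \<ge> vol n K powr (2 / real n) + vol n T powr (2 / real n))))"
proof (intro conjI exI[of _ "2::nat"] exI[of _ "1::real"] allI impI zero_less_one)
qed (simp_all add: frontier_sum_vol_ge)

end
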